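(* Let $\mathcal{R}\subset\mathbb{R}^N\setminus\{0\}$ be a reduced root system, $k$ any (complex-valued) multiplicity function on $\mathcal{R}$, and $a$ any non-zero complex number. Then the differential-difference operators on $\mathbb{R}^N\setminus\{0\}$ $$\mathbb{E}_{k,a}^+=\frac ia\|x\|^a,\qquad\mathbb{E}_{k,a}^-=\frac ia\|x\|^{2-a}\Delta_k,\qquad\mathbb{H}_{k,a}=\frac2a\sum_{i=1}^Nx_i\partial_i+\frac{N+2\langle k\rangle+a-2}{a}$$ form an $\mathfrak{sl}_2$-triple.
   Context: Let $N\ge1$, $\langle\cdot,\cdot\rangle$ the standard inner product on $\mathbb{R}^N$, $\|x\|=\langle x,x\rangle^{1/2}$, $r_\alpha(x)=x-2\frac{\langle\alpha,x\rangle}{\|\alpha\|^2}\alpha$. A (reduced) root system is a finite set $\mathcal{R}\subset\mathbb{R}^N\setminus\{0\}$ with $r_\alpha(\mathcal{R})=\mathcal{R}$ and $\mathcal{R}\cap\mathbb{R}\alpha=\{\pm\alpha\}$ for all $\alpha\in\mathcal{R}$. $\mathfrak{C}$ is the finite Coxeter group generated by the $r_\alpha$; a multiplicity function is a $\mathfrak{C}$-invariant function $k:\mathcal{R}\to\mathbb{C}$, $k_\alpha=k(\alpha)$; $\mathcal{R}^+$ is a positive subsystem and $\langle k\rangle=\sum_{\alpha\in\mathcal{R}^+}k_\alpha$. The Dunkl operators are $T_\xi(k)f(x)=\partial_\xi f(x)+\sum_{\alpha\in\mathcal{R}^+}k_\alpha\langle\alpha,\xi\rangle\frac{f(x)-f(r_\alpha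 x)}{\langle\alpha,x\rangle}$ and the Dunkl Laplacian is $\Delta_k=\sum_{j=1}^NT_{\xi_j}(k)^2$ for an orthonormal basis $(\xi_j)$ of $\mathbb{R}^N$. The operators act on $C^\infty(\mathbb{R}^N\setminus\{0\})$ ($\|x\|^a$ and $\|x\|^{2-a}$ acting by multiplication). An $\mathfrak{sl}_2$-triple is a triple $(e^+,e^-,h)$ of non-zero elements of a Lie algebra (here $\operatorname{End}(C^\infty(\mathbb{R}^N\setminus\{0\}))$ with the commutator bracket) with $[e^+,e^-]=h$, $[h,e^+]=2e^+$, $[h,e^-]=-2e^-$; here $e^\pm=\mathbb{E}_{k,a}^\pm$, $h=\mathbb{H}_{k,a}$. *)

theory Defs
  imports "HOL-Analysis.Analysis" "HOL-Library.Function_Algebras"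
    "HOL-Algebra.Bij" "HOL-Algebra.Generated_Groups"
begin

locale lie_algebra = vector_space sc
  for sc :: "'k::field \<Rightarrow> 'g::ab_group_add \<Rightarrow> 'g" +
  fixes L :: "'g set" and bracket :: "'g \<Rightarrow> 'g \<Rightarrow> 'g"
  assumes subspace_L: "subspace L"
    and bracket_closed: "x \<in> L \<Longrightarrow> y \<in> L \<Longrightarrow> bracket x y \<in> L"
    and bracket_add_left:
      "x \<in> L \<Longrightarrow> y \<in> L \<Longrightarrow> z \<in> L \<Longrightarrow> bracket (x + y) z = bracket x z + bracket y z"
    and bracket_add_right:
      "x \<in> L \<Longrightarrow> y \<in> L \<Longrightarrow> z \<in> L \<Longrightarrow> bracket x (y + z) = bracket x y + bracket x z"
    and bracket_scale_left:
      "x \<in> L \<Longrightarrow> y \<in> L \<Longrightarrow> bracket (sc c x) y = sc c (bracket x y)"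
    and bracket_scale_right:
      "x \<in> L \<Longrightarrow> y \<in> L \<Longrightarrow> bracket x (sc c y) = sc c (bracket x y)"
    and bracket_self: "x \<in> L \<Longrightarrow> bracket x x = 0"
    and jacobi: "x \<in> L \<Longrightarrow> y \<in> L \<Longrightarrow> z \<in> L \<Longrightarrow>
      bracket x (bracket y z) + bracket y (bracket z x) + bracket z (bracket x y) = 0"

definition sl2_triple ::
    "('k::field \<Rightarrow> 'g::ab_group_add \<Rightarrow> 'g) \<Rightarrow> 'g set \<Rightarrow> ('g \<Rightarrow> 'g \<Rightarrow> 'g) \<Rightarrow> 'g \<Rightarrow> 'g \<Rightarrow> 'g \<Rightarrow> bool"
  where "sl2_triple sc L bracket ep em h \<longleftrightarrow>
    lie_algebra sc L bracket \<and>
    ep \<in> L \<and> em \<in> L \<and> h \<in> L \<and>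
    ep \<noteq> 0 \<and> em \<noteq> 0 \<and> h \<noteq> 0 \<and>
    bracket ep em = h \<and>
    bracket h ep = sc 2 ep \<and>
    bracket h em = sc (- 2) em"

text \<open>The endomorphisms of a subspace \<open>V\<close> of an ambient vector space. They are represented by
  total functions that vanish outside \<open>V\<close>, so that equality of functions is equality of
  endomorphisms of \<open>V\<close>, and \<open>0\<close>, \<open>+\<close>, \<open>-\<close> and \<open>\<circ>\<close> on functions are those of \<open>End(V)\<close>.\<close>

definition End_space :: "('k \<Rightarrow> 'v \<Rightarrow> 'v) \<Rightarrow> 'v::ab_group_add set \<Rightarrow> ('v \<Rightarrow> 'v) set"
  where "End_space sc V = {T.
    (\<forall>f\<in>V. T f \<in> V) \<and>
    (\<forall>f\<in>V. \<forall>g\<in>V. T (f + g) = T f + T g) \<and>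
    (\<forall>c. \<forall>f\<in>V. T (sc c f) = sc c (T f)) \<and>
    (\<forall>f. f \<notin> V \<longrightarrow> T f = 0)}"

definition pointwise_scale :: "('k \<Rightarrow> 'w \<Rightarrow> 'w) \<Rightarrow> 'k \<Rightarrow> ('b \<Rightarrow> 'w) \<Rightarrow> ('b \<Rightarrow> 'w)"
  where "pointwise_scale sc c F = (\<lambda>x. sc c (F x))"

definition commutator :: "('v \<Rightarrow> 'v) \<Rightarrow> ('v \<Rightarrow> 'v) \<Rightarrow> 'v::ab_group_add \<Rightarrow> 'v"
  where "commutator S T = (S \<circ> T) - (T \<circ> S)"

lemma lie_algebra_End_space:
  assumes "vector_space sc" "module.subspace sc V"
  shows "lie_algebra (pointwise_scale sc) (End_space sc V) commutator"
proof -
  interpret vector_space sc by fact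
  interpret P: vector_space "pointwise_scale sc :: 'a \<Rightarrow> ('b \<Rightarrow> 'b) \<Rightarrow> _"
    by unfold_locales
      (auto simp: pointwise_scale_def fun_eq_iff scale_right_distrib scale_left_distrib)
  note V = subspace_0[OF assms(2)] subspace_add[OF assms(2)] subspace_scale[OF assms(2)]
    subspace_diff[OF assms(2)]
  have T0: "T 0 = 0" if "T \<in> End_space sc V" for T
  proof -
    have "T (sc 0 0) = sc 0 (T 0)"
      using that V(1) unfolding End_space_def by blast
    then show ?thesis by simp
  qed
  have Tdiff: "T (f - g) = T f - T g" if "T \<in> End_space sc V" "f \<in> V" "g \<in> V" for T f g
  proof -
    have "T ((f - g) + g) = T (f - g) + T g"
      using that V(4) unfolding End_space_def by blast
    then show ?thesis by (simp add: algebra_simps)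
  qed
  have TV: "T f \<in> V" if "T \<in> End_space sc V" for T f
    using that V(1) unfolding End_space_def by (cases "f \<in> V") auto
  have Tadd: "T (f + g) = T f + T g" if "T \<in> End_space sc V" "f \<in> V" "g \<in> V" for T f g
    using that unfolding End_space_def by blast
  have Tsc: "T (sc c f) = sc c (T f)" if "T \<in> End_space sc V" "f \<in> V" for T c f
    using that unfolding End_space_def by blast
  have Tout: "T f = 0" if "T \<in> End_space sc V" "f \<notin> V" for T f
    using that unfolding End_space_def by blast
  show ?thesis
  proof unfold_locales
    show "P.subspace (End_space sc V)"
      unfolding P.subspace_def
      by (auto simp: End_space_def pointwise_scale_def V algebra_simps scale_right_distrib)
  next
    fix S T assume S: "S \<in> End_space sc V" and T: "T \<in> End_space sc V"
    show "commutator S T \<in> End_space sc V"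
      unfolding End_space_def commutator_def
      by (auto simp: V TV[OF S] TV[OF T] Tadd[OF S] Tadd[OF T] Tsc[OF S] Tsc[OF T]
        Tout[OF S] Tout[OF T] T0[OF S] T0[OF T] scale_right_diff_distrib)
    fix c
    show "commutator (pointwise_scale sc c S) T = pointwise_scale sc c (commutator S T)"
      by (auto simp: commutator_def pointwise_scale_def fun_eq_iff scale_right_diff_distrib
        Tsc[OF T] TV[OF S] T0[OF T])
    show "commutator S (pointwise_scale sc c T) = pointwise_scale sc c (commutator S T)"
      by (auto simp: commutator_def pointwise_scale_def fun_eq_iff scale_right_diff_distrib
        Tsc[OF S] TV[OF T] T0[OF S])
    fix U assume U: "U \<in> End_space sc V"
    show "commutator (S + T) U = commutator S U + commutator T U"
      by (auto simp: commutator_def fun_eq_iff Tadd[OF U] TV[OF S] TV[OF T] T0[OF U])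
    show "commutator S (T + U) = commutator S T + commutator S U"
      by (auto simp: commutator_def fun_eq_iff Tadd[OF S] TV[OF T] TV[OF U] T0[OF S])
    show "commutator S (commutator T U) + commutator T (commutator U S)
        + commutator U (commutator S T) = 0"
      by (auto simp: commutator_def fun_eq_iff Tdiff[OF S] Tdiff[OF T] Tdiff[OF U]
        TV[OF S] TV[OF T] TV[OF U] T0[OF S] T0[OF T] T0[OF U])
  qed (auto simp: commutator_def)
qed

text \<open>Class \<open>C^n\<close> on an open set \<open>S\<close>, by iterated directional derivatives.\<close>

primrec Ck_on :: "nat \<Rightarrow> 'a::real_normed_vector set \<Rightarrow> ('a \<Rightarrow> 'b::real_normed_vector) \<Rightarrow> bool"
  where
    "Ck_on 0 S f \<longleftrightarrow> continuous_on S f"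
  | "Ck_on (Suc n) S f \<longleftrightarrow> (\<forall>x\<in>S. f differentiable (at x)) \<and>
      (\<forall>v. Ck_on n S (\<lambda>x. frechet_derivative f (at x) v))"

text \<open>A function on the complement of the origin is represented by its extension by \<open>0\<close> to the
  whole space; nothing is required of this extension at the origin.\<close>

definition Cinf_punctured :: "((real ^ 'n) \<Rightarrow> complex) set"
  where "Cinf_punctured = {f. (\<forall>n. Ck_on n (- {0}) f) \<and> f 0 = 0}"

text \<open>The element of \<open>End_space\<close> given by a formula that is meaningful on
  \<open>Cinf_punctured\<close> and off the origin.\<close>

definition punctured_op ::
    "(((real ^ 'n) \<Rightarrow> complex) \<Rightarrow> (real ^ 'n) \<Rightarrow> complex) \<Rightarrow> ((real ^ 'n) \<Rightarrow> complex) \<Rightarrow> (real ^ 'n) \<Rightarrow> complex"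
  where "punctured_op T f = (if f \<in> Cinf_punctured then (\<lambda>x. if x = 0 then 0 else T f x) else 0)"

definition reflection :: "real ^ 'n \<Rightarrow> real ^ 'n \<Rightarrow> real ^ 'n"
  where "reflection \<alpha> x = x - (2 * (\<alpha> \<bullet> x) / (norm \<alpha>)\<^sup>2) *\<^sub>R \<alpha>"

definition root_system :: "(real ^ 'n) set \<Rightarrow> bool"
  where "root_system R \<longleftrightarrow> finite R \<and> 0 \<notin> R \<and>
    (\<forall>\<alpha>\<in>R. reflection \<alpha> ` R = R \<and> R \<inter> range (\<lambda>t. t *\<^sub>R \<alpha>) = {\<alpha>, - \<alpha>})"

definition coxeter_group :: "(real ^ 'n) set \<Rightarrow> (real ^ 'n \<Rightarrow> real ^ 'n) set"
  where "coxeter_group R = generate (BijGroup UNIV) (reflection ` R)"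

definition multiplicity_function :: "(real ^ 'n) set \<Rightarrow> (real ^ 'n \<Rightarrow> complex) \<Rightarrow> bool"
  where "multiplicity_function R k \<longleftrightarrow> (\<forall>g\<in>coxeter_group R. \<forall>\<alpha>\<in>R. k (g \<alpha>) = k \<alpha>)"

text \<open>A positive subsystem consists of the roots on the positive side of a hyperplane that contains
  no root.\<close>

definition positive_subsystem :: "(real ^ 'n) set \<Rightarrow> (real ^ 'n) set \<Rightarrow> bool"
  where "positive_subsystem R Rp \<longleftrightarrow>
    (\<exists>\<beta>. (\<forall>\<alpha>\<in>R. \<beta> \<bullet> \<alpha> \<noteq> 0) \<and> Rp = {\<alpha>\<in>R. \<beta> \<bullet> \<alpha> > 0})"

text \<open>The difference quotient is understood as its continuous extension across the
  hyperplane orthogonal to \<open>\<alpha>\<close>.\<close>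

definition diff_quotient :: "real ^ 'n \<Rightarrow> (real ^ 'n \<Rightarrow> complex) \<Rightarrow> real ^ 'n \<Rightarrow> complex"
  where "diff_quotient \<alpha> f x =
    (let q = (\<lambda>y. (f y - f (reflection \<alpha> y)) / of_real (\<alpha> \<bullet> y))
     in if \<alpha> \<bullet> x \<noteq> 0 then q x else Lim (at x within {y. \<alpha> \<bullet> y \<noteq> 0}) q)"

definition dunkl_op :: "(real ^ 'n) set \<Rightarrow> (real ^ 'n \<Rightarrow> complex) \<Rightarrow> real ^ 'n \<Rightarrow>
    (real ^ 'n \<Rightarrow> complex) \<Rightarrow> real ^ 'n \<Rightarrow> complex"
  where "dunkl_op Rp k \<xi> f x = frechet_derivative f (at x) \<xi> +
    (\<Sum>\<alpha>\<in>Rp. k \<alpha> * of_real (\<alpha> \<bullet> \<xi>) * diff_quotient \<alpha> f x)"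

definition orthonormal_basis :: "('n \<Rightarrow> real ^ 'n) \<Rightarrow> bool"
  where "orthonormal_basis \<xi> \<longleftrightarrow> (\<forall>i j. \<xi> i \<bullet> \<xi> j = (if i = j then 1 else 0))"

definition dunkl_laplacian :: "('n \<Rightarrow> real ^ 'n) \<Rightarrow> (real ^ 'n) set \<Rightarrow> (real ^ 'n \<Rightarrow> complex) \<Rightarrow>
    (real ^ 'n \<Rightarrow> complex) \<Rightarrow> real ^ 'n \<Rightarrow> complex"
  where "dunkl_laplacian \<xi> Rp k f x =
    (\<Sum>j\<in>UNIV. dunkl_op Rp k (\<xi> j) (dunkl_op Rp k (\<xi> j) f) x)"

definition E_plus :: "complex \<Rightarrow> (real ^ 'n \<Rightarrow> complex) \<Rightarrow> real ^ 'n \<Rightarrow> complex"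
  where "E_plus a = punctured_op (\<lambda>f x. \<i> / a * of_real (norm x) powr a * f x)"

definition E_minus :: "('n \<Rightarrow> real ^ 'n) \<Rightarrow> (real ^ 'n) set \<Rightarrow> (real ^ 'n \<Rightarrow> complex) \<Rightarrow> complex \<Rightarrow>
    (real ^ 'n \<Rightarrow> complex) \<Rightarrow> real ^ 'n \<Rightarrow> complex"
  where "E_minus \<xi> Rp k a = punctured_op (\<lambda>f x.
    \<i> / a * of_real (norm x) powr (2 - a) * dunkl_laplacian \<xi> Rp k f x)"

definition H_op :: "(real ^ 'n) set \<Rightarrow> (real ^ 'n \<Rightarrow> complex) \<Rightarrow> complex \<Rightarrow>
    (real ^ 'n \<Rightarrow> complex) \<Rightarrow> real ^ 'n \<Rightarrow> complex"
  where "H_op Rp k a = punctured_op (\<lambda>f x.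
    2 / a * (\<Sum>i\<in>UNIV. of_real (x $ i) * frechet_derivative f (at x) (axis i 1)) +
    (of_nat CARD('n) + 2 * (\<Sum>\<alpha>\<in>Rp. k \<alpha>) + a - 2) / a * f x)"

end

theory Submission
  imports Defs
begin

text \<open>Write \<open>T\<^sub>\<xi>\<close> for the Dunkl operators, \<open>\<Delta>\<^sub>k = \<Sum>\<^sub>j T\<^sub>j\<^sup>2\<close> for the Dunkl Laplacian and \<open>\<E>\<close> for the Euler operator
  \<open>\<Sum>\<^sub>i x\<^sub>i \<partial>\<^sub>i\<close>. The relations of the triple express two facts.

  First, \<open>\<Delta>\<^sub>k\<close> is homogeneous of degree \<open>-2\<close>, that is \<open>\<Delta>\<^sub>k \<E> = \<E> \<Delta>\<^sub>k + 2 \<Delta>\<^sub>k\<close> (lemma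
  \<open>dunkl_laplacian_euler_op\<close>), since each \<open>T\<^sub>\<xi>\<close> has degree \<open>-1\<close>; multiplication by \<open>norm x powr b\<close> has
  degree \<open>b\<close>. As \<open>H\<close> is \<open>(2 / a) \<E>\<close> up to an additive scalar, this gives \<open>[H, E\<^sup>\<plusminus>] = \<plusminus> 2 E\<^sup>\<plusminus>\<close>.

  Second, the commutator of \<open>\<Delta>\<^sub>k\<close> with a power of the norm is a first-order differential operator,
  \<open>\<Delta>\<^sub>k (norm\<^sup>a f) - norm\<^sup>a \<Delta>\<^sub>k f = a norm\<^sup>a\<^sup>-\<^sup>2 ((N + 2 \<langle>k\<rangle> + a - 2) f + 2 \<E> f)\<close> (lemma
  \<open>dunkl_laplacian_norm_powr\<close>). It follows from the product rule
  \<open>T\<^sub>\<xi> (\<phi> f) = (\<partial>\<^sub>\<xi> \<phi>) f + \<phi> T\<^sub>\<xi> f\<close> for radial \<open>\<phi>\<close> and from the formula for \<open>T\<^sub>\<xi>\<close> applied to a linear form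
  times \<open>f\<close>; the reflected values of \<open>f\<close> cancel after summation over the basis. This gives
  \<open>[E\<^sup>+, E\<^sup>-] = H\<close>.

  The analytic input is that the operators preserve smoothness off the origin. The only delicate point
  is the quotient \<open>(f x - f (r\<^sub>\<alpha> x)) / (\<alpha> \<bullet> x)\<close> at the hyperplane orthogonal to \<open>\<alpha>\<close>, where it
  equals an integral of a derivative of \<open>f\<close> over the segment from \<open>x\<close> to \<open>r\<^sub>\<alpha> x\<close>
  (\<open>hadamard_reflection\<close>, \<open>Ck_on_segment_integral\<close>). Algebraic identities for the quotient are proved
  after multiplication by \<open>\<alpha> \<bullet> x\<close> and hold on the hyperplane by continuity
  (\<open>diff_quotient_eqI\<close>). Homogeneity of the derivatives uses the symmetry of second derivatives
  (\<open>dir_deriv_commute\<close>).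

  Finally \<open>H\<close> is not zero, because it has at least two different eigenvalues on powers of the norm
  (\<open>H_op_nonzero\<close>), and so neither are \<open>E\<^sup>+\<close> and \<open>E\<^sup>-\<close>.\<close>

section \<open>Functions of class C^n and smooth functions\<close>

definition smooth_on :: "'a::real_normed_vector set \<Rightarrow> ('a \<Rightarrow> 'b::real_normed_vector) \<Rightarrow> bool"
  where "smooth_on S f \<longleftrightarrow> (\<forall>n. Ck_on n S f)"

definition dir_deriv :: "'a::real_normed_vector \<Rightarrow> ('a \<Rightarrow> 'b::real_normed_vector) \<Rightarrow> 'a \<Rightarrow> 'b"
  where "dir_deriv v f x = frechet_derivative f (at x) v"

lemma dir_deriv_eqI:
  assumes "(f has_derivative f') (at x)"
  shows "dir_deriv v f x = f' v"
  using frechet_derivative_at[OF assms] by (simp add: dir_deriv_def)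

lemma Ck_on_cong:
  assumes "open S" "\<And>x. x \<in> S \<Longrightarrow> f x = g x"
  shows "Ck_on n S f = Ck_on n S g"
proof -
  have "Ck_on n S g" if "Ck_on n S f" "\<And>x. x \<in> S \<Longrightarrow> f x = g x" for f g
    using that
  proof (induction n arbitrary: f g)
    case 0
    then show ?case using continuous_on_eq[of S f g] by auto
  next
    case (Suc n)
    have "g differentiable (at x)" if "x \<in> S" for x
    proof -
      have "(f has_derivative frechet_derivative f (at x)) (at x)"
        using Suc.prems(1) that frechet_derivative_works[of f "at x"] by simp
      then show ?thesis
        using has_derivative_transform_within_open[OF _ assms(1) that] Suc.prems(2)
        unfolding differentiable_def by blast
    qed
    moreover have "frechet_derivative f (at x) = frechet_derivative g (at x)" if "x \<in> S" for x
      using frechet_derivative_transform_within_open[OF _ assms(1) that] Suc.prems that by auto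
    moreover have "Ck_on n S (\<lambda>x. frechet_derivative f (at x) v)" for v
      using Suc.prems(1) by simp
    then have "Ck_on n S (\<lambda>x. frechet_derivative g (at x) v)" for v
      by (rule Suc.IH) (simp add: calculation(2))
    ultimately show ?case by simp
  qed
  from this[of f g] this[of g f] show ?thesis using assms(2) by auto
qed

text \<open>The choice of a derivative in a proof of differentiability is immaterial: any family \<open>f'\<close> may
  stand in for \<^const>\<open>frechet_derivative\<close>. Closure under sums, products, inverses and segment
  integrals is proved by induction with this rule.\<close>

lemma Ck_on_SucI:
  assumes "open S" "\<And>x. x \<in> S \<Longrightarrow> (f has_derivative f' x) (at x)"
    and "\<And>v. Ck_on n S (\<lambda>x. f' x v)"
  shows "Ck_on (Suc n) S f"
proof -
  have "frechet_derivative f (at x) v = f' x v" if "x \<in> S" for x v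
    using frechet_derivative_at[OF assms(2)[OF that]] by simp
  then have "Ck_on n S (\<lambda>x. frechet_derivative f (at x) v)" for v
    by (subst Ck_on_cong[OF assms(1), of _ "\<lambda>x. f' x v"]) (auto intro: assms(3))
  then show ?thesis
    using assms(2) unfolding Ck_on.simps(2) differentiable_def by blast
qed

lemma Ck_on_has_derivative:
  assumes "Ck_on (Suc n) S f" "x \<in> S"
  shows "(f has_derivative (\<lambda>v. dir_deriv v f x)) (at x)"
  using assms frechet_derivative_works[of f "at x"] by (simp add: dir_deriv_def)

lemma Ck_on_dir_deriv: "Ck_on (Suc n) S f \<Longrightarrow> Ck_on n S (dir_deriv v f)"
  unfolding dir_deriv_def[abs_def] by simp

lemma Ck_on_pred: "Ck_on (Suc n) S f \<Longrightarrow> Ck_on n S f"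
proof (induction n arbitrary: f)
  case 0
  then have "\<forall>x\<in>S. continuous (at x) f"
    using differentiable_imp_continuous_within by auto
  then show ?case
    by (simp add: continuous_at_imp_continuous_on)
next
  case (Suc n)
  have "Ck_on (Suc n) S (\<lambda>x. frechet_derivative f (at x) v)" for v
    using Suc.prems by (subst (asm) Ck_on.simps(2)) blast
  then have "Ck_on n S (\<lambda>x. frechet_derivative f (at x) v)" for v
    by (rule Suc.IH)
  then show ?case
    using Suc.prems by auto
qed

lemma Ck_on_imp_continuous_on: "Ck_on n S f \<Longrightarrow> continuous_on S f"
  by (induction n) (auto dest: Ck_on_pred simp del: Ck_on.simps(2))

lemma Ck_on_subset: "Ck_on n S f \<Longrightarrow> T \<subseteq> S \<Longrightarrow> Ck_on n T f"
  by (induction n arbitrary: f) (auto intro: continuous_on_subset)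

lemma Ck_on_Union:
  assumes "\<And>S. S \<in> F \<Longrightarrow> open S" "\<And>S. S \<in> F \<Longrightarrow> Ck_on n S f"
  shows "Ck_on n (\<Union>F) f"
  using assms(2)
proof (induction n arbitrary: f)
  case 0
  then show ?case
    using continuous_on_open_Union[of F f] assms(1) by simp
next
  case (Suc n)
  then show ?case by auto
qed

lemma Ck_on_const: "open S \<Longrightarrow> Ck_on n S (\<lambda>x. c)"
  by (induction n arbitrary: c) auto

lemma Ck_on_add:
  assumes "open S" "Ck_on n S f" "Ck_on n S g"
  shows "Ck_on n S (\<lambda>x. f x + g x)"
  using assms(2,3)
proof (induction n arbitrary: f g)
  case (Suc n)
  show ?case
  proof (rule Ck_on_SucI[OF assms(1)])
    show "((\<lambda>x. f x + g x) has_derivative (\<lambda>v. dir_deriv v f x + dir_deriv v g x)) (at x)"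
      if "x \<in> S" for x
      using that Suc.prems by (intro has_derivative_add Ck_on_has_derivative)
    show "Ck_on n S (\<lambda>x. dir_deriv v f x + dir_deriv v g x)" for v
      by (intro Suc.IH Ck_on_dir_deriv Suc.prems)
  qed
qed (auto intro!: continuous_intros)

lemma Ck_on_mult:
  fixes f g :: "_ \<Rightarrow> 'b::real_normed_algebra"
  assumes "open S" "Ck_on n S f" "Ck_on n S g"
  shows "Ck_on n S (\<lambda>x. f x * g x)"
  using assms(2,3)
proof (induction n arbitrary: f g)
  case (Suc n)
  note D = Ck_on_dir_deriv[OF Suc.prems(1)] Ck_on_dir_deriv[OF Suc.prems(2)]
  note P = Ck_on_pred[OF Suc.prems(1)] Ck_on_pred[OF Suc.prems(2)]
  show ?case
  proof (rule Ck_on_SucI[OF assms(1)])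
    show "((\<lambda>x. f x * g x) has_derivative (\<lambda>v. f x * dir_deriv v g x + dir_deriv v f x * g x)) (at x)"
      if "x \<in> S" for x
      using that Suc.prems by (intro has_derivative_mult Ck_on_has_derivative)
    show "Ck_on n S (\<lambda>x. f x * dir_deriv v g x + dir_deriv v f x * g x)" for v
      by (intro Ck_on_add Suc.IH D P assms(1))
  qed
qed (auto intro!: continuous_intros)

lemma Ck_on_inverse:
  fixes f :: "_ \<Rightarrow> 'b::real_normed_field"
  assumes "open S" "Ck_on n S f" "\<And>x. x \<in> S \<Longrightarrow> f x \<noteq> 0"
  shows "Ck_on n S (\<lambda>x. inverse (f x))"
  using assms(2,3)
proof (induction n arbitrary: f)
  case (Suc n)
  have 1: "Ck_on n S (\<lambda>x. inverse (f x))"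
    using Suc.IH[OF Ck_on_pred[OF Suc.prems(1)]] Suc.prems(2) by blast
  show ?case
  proof (rule Ck_on_SucI[OF assms(1)])
    show "((\<lambda>x. inverse (f x)) has_derivative
        (\<lambda>v. - 1 * (inverse (f x) * dir_deriv v f x * inverse (f x)))) (at x)" if "x \<in> S" for x
      using Deriv.has_derivative_inverse[OF Suc.prems(2)[OF that] Ck_on_has_derivative[OF Suc.prems(1) that]]
      by simp
    show "Ck_on n S (\<lambda>x. - 1 * (inverse (f x) * dir_deriv v f x * inverse (f x)))" for v
      by (intro Ck_on_mult assms(1) 1 Ck_on_dir_deriv[OF Suc.prems(1)] Ck_on_const)
  qed
qed (auto intro!: continuous_intros)

lemma Ck_on_compose_linear:
  assumes "open S" "bounded_linear L" "L ` S \<subseteq> T" "Ck_on n T f"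
  shows "Ck_on n S (\<lambda>x. f (L x))"
  using assms(4)
proof (induction n arbitrary: f)
  case 0
  interpret bounded_linear L by fact
  show ?case
    using 0 assms(3) continuous_on
    by (auto intro!: continuous_on_compose2[of T f S L] bounded_linear.continuous_on[OF assms(2)])
next
  case (Suc n)
  have "((\<lambda>x. f (L x)) has_derivative (\<lambda>v. dir_deriv (L v) f (L x))) (at x)" if "x \<in> S" for x
    using has_derivative_compose[OF bounded_linear_imp_has_derivative[OF assms(2)]
        Ck_on_has_derivative[OF Suc.prems]] assms(3) that by blast
  then show ?case
    using Suc.IH[OF Ck_on_dir_deriv[OF Suc.prems]] by (intro Ck_on_SucI[OF assms(1)])
qed

lemma Ck_on_bounded_linear:
  assumes "open S" "bounded_linear L"
  shows "Ck_on n S L"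
proof (cases n)
  case 0
  then show ?thesis using bounded_linear.continuous_on[OF assms(2) continuous_on_id] by simp
next
  case (Suc m)
  then show ?thesis
    using Ck_on_SucI[OF assms(1) bounded_linear_imp_has_derivative[OF assms(2)]
      Ck_on_const[OF assms(1)]] by simp
qed

lemma smooth_onD:
  assumes "smooth_on S f"
  shows smooth_on_has_derivative: "x \<in> S \<Longrightarrow> (f has_derivative (\<lambda>v. dir_deriv v f x)) (at x)"
    and smooth_on_dir_deriv: "smooth_on S (dir_deriv v f)"
    and smooth_on_continuous: "continuous_on S f"
  using assms Ck_on_has_derivative Ck_on_dir_deriv Ck_on.simps(1) unfolding smooth_on_def by blast+

section \<open>Symmetry of second derivatives\<close>

text \<open>Along the segment from \<open>y\<close> to \<open>y + s u\<close>, the fundamental theorem gives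
  \<open>f (y + s u) - f y = \<integral>\<^sub>0\<^sup>s dir_deriv u f (y + \<sigma> u) d\<sigma>\<close>. Differentiating this in \<open>y\<close> in the
  direction \<open>v\<close> under the integral sign, and then in \<open>s\<close> at \<open>s = 0\<close>, exchanges the two
  derivatives.\<close>

lemma dir_deriv_commute:
  fixes f :: "'a::real_normed_vector \<Rightarrow> 'b::banach"
  assumes "open S" "smooth_on S f" "x \<in> S"
  shows "dir_deriv u (dir_deriv v f) x = dir_deriv v (dir_deriv u f) x"
proof -
  have d: "((\<lambda>s. g (y + s *\<^sub>R w)) has_vector_derivative dir_deriv w g (y + s *\<^sub>R w)) (at s within A)"
    if g: "smooth_on S g" "y + s *\<^sub>R w \<in> S" for g :: "'a \<Rightarrow> 'b" and y w s A
  proof -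
    have "((\<lambda>s. y + s *\<^sub>R w) has_derivative (\<lambda>h. h *\<^sub>R w)) (at s within A)"
      by (auto intro!: derivative_eq_intros)
    note has_derivative_compose[OF this smooth_on_has_derivative[OF g]]
    moreover have "dir_deriv (h *\<^sub>R w) g (y + s *\<^sub>R w) = h *\<^sub>R dir_deriv w g (y + s *\<^sub>R w)" for h
      by (rule linear_scale[OF has_derivative_linear[OF smooth_on_has_derivative[OF g]]])
    ultimately show ?thesis
      unfolding has_vector_derivative_def by simp
  qed
  obtain e where e: "e > 0" "ball x e \<subseteq> S" using openE[OF assms(1,3)] .
  \<comment> \<open>so small that the closed parallelogram spanned by \<open>\<delta> u\<close> and \<open>\<delta> v\<close> stays in the ball\<close>
  define \<delta> where "\<delta> = e / (2 * (norm u + norm v + 1))"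
  have pos: "norm u + norm v + 1 > 0" using norm_ge_zero[of u] norm_ge_zero[of v] by linarith
  have \<delta>: "\<delta> > 0" using e(1) pos by (simp add: \<delta>_def)
  have inS: "x + t *\<^sub>R v + s *\<^sub>R u \<in> S" if "\<bar>s\<bar> \<le> \<delta>" "\<bar>t\<bar> \<le> \<delta>" for s t
  proof -
    have "norm (t *\<^sub>R v + s *\<^sub>R u) \<le> \<bar>t\<bar> * norm v + \<bar>s\<bar> * norm u"
      by (metis norm_scaleR norm_triangle_ineq)
    also have "\<dots> \<le> \<delta> * norm v + \<delta> * norm u"
      using that by (intro add_mono mult_right_mono) auto
    also have "\<dots> \<le> \<delta> * (norm u + norm v + 1)"
      using \<delta> by (simp add: algebra_simps)
    also have "\<dots> = e / 2" using pos by (simp add: \<delta>_def field_split_simps)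
    finally have "norm (t *\<^sub>R v + s *\<^sub>R u) < e" using e(1) by simp
    then have "x + (t *\<^sub>R v + s *\<^sub>R u) \<in> ball x e"
      by (metis add_diff_cancel_left' dist_commute dist_norm mem_ball)
    then show ?thesis using e(2) by (metis add.assoc subsetD)
  qed
  note fu = smooth_on_dir_deriv[OF assms(2), of u]
  have FTC: "((\<lambda>\<sigma>. dir_deriv u f (x + t *\<^sub>R v + \<sigma> *\<^sub>R u)) has_integral
      (f (x + t *\<^sub>R v + s *\<^sub>R u) - f (x + t *\<^sub>R v))) {0..s}"
    if "0 \<le> s" "s \<le> \<delta>" "\<bar>t\<bar> \<le> \<delta>" for s t
  proof -
    have "((\<lambda>\<sigma>. f (x + t *\<^sub>R v + \<sigma> *\<^sub>R u)) has_vector_derivative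
        dir_deriv u f (x + t *\<^sub>R v + \<sigma> *\<^sub>R u)) (at \<sigma> within {0..s})" if "\<sigma> \<in> {0..s}" for \<sigma>
      by (rule d[OF assms(2) inS]) (use that \<open>s \<le> \<delta>\<close> \<open>\<bar>t\<bar> \<le> \<delta>\<close> in auto)
    from fundamental_theorem_of_calculus[OF \<open>0 \<le> s\<close> this] show ?thesis by simp
  qed
  have *: "integral {0..s} (\<lambda>\<sigma>. dir_deriv v (dir_deriv u f) (x + \<sigma> *\<^sub>R u))
      = dir_deriv v f (x + s *\<^sub>R u) - dir_deriv v f x" if s: "0 \<le> s" "s \<le> \<delta>" for s
  proof -
    let ?U = "{-\<delta><..<\<delta>}"
    have "((\<lambda>t. integral (cbox 0 s) (\<lambda>\<sigma>. dir_deriv u f (x + t *\<^sub>R v + \<sigma> *\<^sub>R u)))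
      has_vector_derivative
        integral (cbox 0 s) (\<lambda>\<sigma>. dir_deriv v (dir_deriv u f) (x + 0 *\<^sub>R v + \<sigma> *\<^sub>R u)))
      (at 0 within ?U)"
    proof (rule leibniz_rule_vector_derivative)
      fix t \<sigma> assume t: "t \<in> ?U" and \<sigma>: "\<sigma> \<in> cbox 0 s"
      have "((\<lambda>t. dir_deriv u f ((x + \<sigma> *\<^sub>R u) + t *\<^sub>R v)) has_vector_derivative
         dir_deriv v (dir_deriv u f) ((x + \<sigma> *\<^sub>R u) + t *\<^sub>R v)) (at t within ?U)"
      proof (rule d[OF fu])
        have "x + t *\<^sub>R v + \<sigma> *\<^sub>R u \<in> S" by (rule inS) (use s t \<sigma> in auto)
        then show "x + \<sigma> *\<^sub>R u + t *\<^sub>R v \<in> S" by (simp add: add_ac)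
      qed
      then show "((\<lambda>t. dir_deriv u f (x + t *\<^sub>R v + \<sigma> *\<^sub>R u)) has_vector_derivative
         dir_deriv v (dir_deriv u f) (x + t *\<^sub>R v + \<sigma> *\<^sub>R u)) (at t within ?U)"
        by (simp add: add_ac)
    next
      fix t assume "t \<in> ?U"
      then show "(\<lambda>\<sigma>. dir_deriv u f (x + t *\<^sub>R v + \<sigma> *\<^sub>R u)) integrable_on cbox 0 s"
        using FTC[of s t] s unfolding box_real integrable_on_def
        by (metis abs_le_iff greaterThanLessThan_iff less_imp_le minus_le_iff)
    next
      show "continuous_on (?U \<times> cbox 0 s)
        (\<lambda>(t, \<sigma>). dir_deriv v (dir_deriv u f) (x + t *\<^sub>R v + \<sigma> *\<^sub>R u))"
        unfolding split_beta
        by (rule continuous_on_compose2[OF smooth_on_continuous[OF smooth_on_dir_deriv[OF fu]]])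
          (use s in \<open>auto intro!: continuous_intros inS\<close>)
    qed (use \<delta> in auto)
    then have "((\<lambda>t. integral {0..s} (\<lambda>\<sigma>. dir_deriv u f (x + t *\<^sub>R v + \<sigma> *\<^sub>R u)))
      has_vector_derivative
        integral {0..s} (\<lambda>\<sigma>. dir_deriv v (dir_deriv u f) (x + \<sigma> *\<^sub>R u))) (at 0)"
      using \<delta> by (simp add: at_within_open[of 0 ?U])
    then have "((\<lambda>t. f (x + t *\<^sub>R v + s *\<^sub>R u) - f (x + t *\<^sub>R v)) has_vector_derivative
        integral {0..s} (\<lambda>\<sigma>. dir_deriv v (dir_deriv u f) (x + \<sigma> *\<^sub>R u))) (at 0)"
      by (rule has_vector_derivative_transform_within_open[where S="?U"])
        (use \<delta> FTC s in \<open>auto intro!: integral_unique\<close>)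
    moreover have "((\<lambda>t. f ((x + s *\<^sub>R u) + t *\<^sub>R v) - f (x + t *\<^sub>R v)) has_vector_derivative
        dir_deriv v f ((x + s *\<^sub>R u) + 0 *\<^sub>R v) - dir_deriv v f (x + 0 *\<^sub>R v)) (at 0)"
      by (intro has_vector_derivative_diff d assms) (use inS[of s 0] assms(3) s \<delta> in auto)
    then have "((\<lambda>t. f (x + t *\<^sub>R v + s *\<^sub>R u) - f (x + t *\<^sub>R v)) has_vector_derivative
        dir_deriv v f (x + s *\<^sub>R u) - dir_deriv v f x) (at 0)"
      by (simp add: add_ac)
    ultimately show ?thesis
      by (rule vector_derivative_unique_at)
  qed
  have "continuous_on {0..\<delta>} (\<lambda>\<sigma>. dir_deriv v (dir_deriv u f) (x + \<sigma> *\<^sub>R u))"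
    by (rule continuous_on_compose2[OF smooth_on_continuous[OF smooth_on_dir_deriv[OF fu]]])
      (use inS[of _ 0] \<delta> in \<open>auto intro!: continuous_intros simp: image_subset_iff\<close>)
  from integral_has_vector_derivative[OF this, of 0]
  have "((\<lambda>s. integral {0..s} (\<lambda>\<sigma>. dir_deriv v (dir_deriv u f) (x + \<sigma> *\<^sub>R u)))
     has_vector_derivative dir_deriv v (dir_deriv u f) x) (at 0 within {0..\<delta>})"
    using \<delta> by simp
  then have "((\<lambda>s. dir_deriv v f (x + s *\<^sub>R u) - dir_deriv v f x)
     has_vector_derivative dir_deriv v (dir_deriv u f) x) (at 0 within {0..\<delta>})"
    by (rule has_vector_derivative_transform[rotated 2]) (use \<delta> * in auto)
  moreover have "((\<lambda>s. dir_deriv v f (x + s *\<^sub>R u) - dir_deriv v f x) has_vector_derivative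
     dir_deriv u (dir_deriv v f) (x + 0 *\<^sub>R u) - 0) (at 0 within {0..\<delta>})"
    by (intro has_vector_derivative_diff d smooth_on_dir_deriv assms has_vector_derivative_const)
      (use assms in auto)
  then have "((\<lambda>s. dir_deriv v f (x + s *\<^sub>R u) - dir_deriv v f x) has_vector_derivative
     dir_deriv u (dir_deriv v f) x) (at 0 within {0..\<delta>})"
    by simp
  ultimately have "dir_deriv v (dir_deriv u f) x = dir_deriv u (dir_deriv v f) x"
    by (rule vector_derivative_unique_within_closed_interval[OF \<delta>, unfolded box_real, rotated])
      (use \<delta> in auto)
  then show ?thesis ..
qed

section \<open>Integrals along segments\<close>

text \<open>Differentiation under the integral sign in the direction \<open>v\<close> produces two integrals of the same
  form, with the functions \<open>dir_deriv v h\<close> and \<open>dir_deriv (r v) h\<close> and the weights \<open>(1 - t) w(t)\<close>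
  and \<open>t w(t)\<close>. The arbitrary weight makes the induction on \<open>n\<close> work.\<close>

lemma Ck_on_segment_integral:
  fixes h :: "'a::euclidean_space \<Rightarrow> 'b::banach"
  assumes U: "open U" "convex U" and r: "bounded_linear r" "r ` U \<subseteq> U"
    and "Ck_on n U h" "continuous_on {0..1} w"
  shows "Ck_on n U (\<lambda>x. integral {0..1} (\<lambda>t. w t *\<^sub>R h ((1 - t) *\<^sub>R x + t *\<^sub>R r x)))"
  using assms(5,6)
proof (induction n arbitrary: h w)
  have seg: "(1 - t) *\<^sub>R x + t *\<^sub>R r x \<in> U" if "x \<in> U" "t \<in> {0..1}" for x t
    using convexD_alt[OF U(2)] that r(2) by (auto simp: image_subset_iff)
  have cont: "continuous_on (U \<times> {0..1}) (\<lambda>z. w (snd z) *\<^sub>R h ((1 - snd z) *\<^sub>R fst z + snd z *\<^sub>R r (fst z)))"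
    if "continuous_on U h" "continuous_on {0..1} w" for h :: "'a \<Rightarrow> 'b" and w :: "real \<Rightarrow> real"
    by (intro continuous_intros continuous_on_compose2[OF that(1)] continuous_on_compose2[OF that(2)]
        bounded_linear.continuous_on[OF r(1)]) (auto intro: seg)
  {
    case 0
    have "continuous_on U (\<lambda>x. integral (cbox 0 1) (\<lambda>t. w t *\<^sub>R h ((1 - t) *\<^sub>R x + t *\<^sub>R r x)))"
      by (rule integral_continuous_on_param) (use cont 0 in \<open>simp add: split_beta\<close>)
    then show ?case by simp
  next
    case (Suc n)
    define I where "I h w x = integral {0..1} (\<lambda>t. w t *\<^sub>R h ((1 - t) *\<^sub>R x + t *\<^sub>R r x))"
      for h :: "'a \<Rightarrow> 'b" and w x
    let ?A = "\<lambda>x t. (1 - t) *\<^sub>R x + t *\<^sub>R r x"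
    \<comment> \<open>the derivative of the integrand, to be split into the two weighted parts\<close>
    define D where "D x t = (\<lambda>v. w t *\<^sub>R dir_deriv (?A v t) h (?A x t))" for x t
    have hder: "((\<lambda>x. w t *\<^sub>R h (?A x t)) has_derivative D x t) (at x)"
      if "x \<in> U" "t \<in> {0..1}" for x t
    proof -
      have "((\<lambda>x. ?A x t) has_derivative (\<lambda>v. ?A v t)) (at x)"
        by (intro has_derivative_add has_derivative_scaleR_right has_derivative_ident
            bounded_linear_imp_has_derivative r)
      from has_derivative_compose[OF this Ck_on_has_derivative[OF Suc.prems(1) seg[OF that]]]
      show ?thesis unfolding D_def by (rule has_derivative_scaleR_right)
    qed
    have bl: "blinfun_apply (Blinfun (D x t)) = D x t" if "x \<in> U" "t \<in> {0..1}" for x t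
      using has_derivative_bounded_linear[OF hder[OF that]] by (rule bounded_linear_Blinfun_apply)
    have Dsplit: "D x t v = ((1 - t) * w t) *\<^sub>R dir_deriv v h (?A x t)
        + (t * w t) *\<^sub>R dir_deriv (r v) h (?A x t)" if "x \<in> U" "t \<in> {0..1}" for x t v
    proof -
      have "linear (\<lambda>v. dir_deriv v h (?A x t))"
        using has_derivative_linear[OF Ck_on_has_derivative[OF Suc.prems(1) seg[OF that]]] .
      from linear_add[OF this] linear_scale[OF this] show ?thesis
        by (simp add: D_def scaleR_right_distrib mult.commute)
    qed
    have hc: "continuous_on U h" "continuous_on U (dir_deriv v h)" for v
      using Ck_on_imp_continuous_on[OF Suc.prems(1)]
        Ck_on_imp_continuous_on[OF Ck_on_dir_deriv[OF Suc.prems(1), of v]] .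
    have wc: "continuous_on {0..1} (\<lambda>t. (1 - t) * w t)" "continuous_on {0..1} (\<lambda>t. t * w t)"
      by (intro continuous_intros Suc.prems)+
    have Dc: "continuous_on (U \<times> {0..1}) (\<lambda>z. D (fst z) (snd z) v)" for v
      using continuous_on_add[OF cont[OF hc(2) wc(1)] cont[OF hc(2) wc(2)], of v "r v"]
      by (rule continuous_on_eq) (auto simp: Dsplit)
    have Bc: "continuous_on (U \<times> {0..1}) (\<lambda>z. Blinfun (D (fst z) (snd z)))"
      by (rule continuous_on_blinfun_componentwise, rule continuous_on_eq[OF Dc]) (auto simp: bl)
    have int: "continuous_on {0..1} (\<lambda>t. w t *\<^sub>R h (?A x t))"
      if "continuous_on U h" "continuous_on {0..1} w" "x \<in> U" for h :: "'a \<Rightarrow> 'b" and w x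
    proof -
      have "continuous_on {0..1} (\<lambda>t. (x, t))" "(\<lambda>t. (x, t)) ` {0..1} \<subseteq> U \<times> {0..1}"
        using that(3) by (auto intro!: continuous_intros)
      from continuous_on_compose2[OF cont[OF that(1,2)] this] show ?thesis by simp
    qed
    have der: "(I h w has_derivative (\<lambda>v. I (dir_deriv v h) (\<lambda>t. (1 - t) * w t) x
        + I (dir_deriv (r v) h) (\<lambda>t. t * w t) x)) (at x)" if x: "x \<in> U" for x
    proof -
      have "((\<lambda>x. integral (cbox 0 1) (\<lambda>t. w t *\<^sub>R h (?A x t))) has_derivative
          integral (cbox 0 1) (\<lambda>t. Blinfun (D x t))) (at x within U)"
        by (rule leibniz_rule[OF _ _ _ x U(2)])
          (use Bc in \<open>auto simp: bl split_beta intro!: has_derivative_at_withinI[OF hder]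
             integrable_continuous_interval int hc Suc.prems\<close>)
      moreover have "blinfun_apply (integral {0..1} (\<lambda>t. Blinfun (D x t))) v =
          I (dir_deriv v h) (\<lambda>t. (1 - t) * w t) x + I (dir_deriv (r v) h) (\<lambda>t. t * w t) x" for v
      proof -
        have "(\<lambda>t. Blinfun (D x t)) integrable_on {0..1}"
        proof (rule integrable_continuous_interval)
          have "continuous_on {0..1} (\<lambda>t. (x, t))" "(\<lambda>t. (x, t)) ` {0..1} \<subseteq> U \<times> {0..1}"
            using x by (auto intro!: continuous_intros)
          from continuous_on_compose2[OF Bc this]
          show "continuous_on {0..1} (\<lambda>t. Blinfun (D x t))" by simp
        qed
        then have "blinfun_apply (integral {0..1} (\<lambda>t. Blinfun (D x t))) v
            = integral {0..1} (\<lambda>t. blinfun_apply (Blinfun (D x t)) v)"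
          by (rule blinfun_apply_integral)
        also have "\<dots> = integral {0..1} (\<lambda>t. ((1 - t) * w t) *\<^sub>R dir_deriv v h (?A x t)
            + (t * w t) *\<^sub>R dir_deriv (r v) h (?A x t))"
          by (rule integral_cong) (use x in \<open>simp add: bl Dsplit\<close>)
        also have "\<dots> = I (dir_deriv v h) (\<lambda>t. (1 - t) * w t) x + I (dir_deriv (r v) h) (\<lambda>t. t * w t) x"
          unfolding I_def
          by (intro integral_add integrable_continuous_interval int hc wc x)
        finally show ?thesis .
      qed
      then have "blinfun_apply (integral {0..1} (\<lambda>t. Blinfun (D x t))) =
          (\<lambda>v. I (dir_deriv v h) (\<lambda>t. (1 - t) * w t) x + I (dir_deriv (r v) h) (\<lambda>t. t * w t) x)"
        by blast
      ultimately show ?thesis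
        using x by (simp add: at_within_open[OF _ U(1)] I_def[of h w, abs_def, symmetric])
    qed
    have "Ck_on (Suc n) U (I h w)"
      by (rule Ck_on_SucI[OF U(1) der])
        (auto simp: I_def[abs_def] intro!: Ck_on_add U Suc.IH Ck_on_dir_deriv Suc.prems wc simp del: Ck_on.simps)
    then show ?case by (simp add: I_def[abs_def])
  }
qed

section \<open>Calculus of smooth functions\<close>

lemma smooth_on_cong:
  assumes "open S" "\<And>x. x \<in> S \<Longrightarrow> f x = g x" "smooth_on S f"
  shows "smooth_on S g"
  using assms(3) Ck_on_cong[of S f g, OF assms(1,2)] unfolding smooth_on_def by simp

lemma smooth_on_subset: "smooth_on S f \<Longrightarrow> T \<subseteq> S \<Longrightarrow> smooth_on T f"
  unfolding smooth_on_def using Ck_on_subset by blast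

lemma smooth_on_local:
  assumes "\<And>x. x \<in> S \<Longrightarrow> \<exists>U. open U \<and> x \<in> U \<and> smooth_on U f"
  shows "smooth_on S f"
proof -
  have "smooth_on (\<Union>{U. open U \<and> smooth_on U f}) f"
    unfolding smooth_on_def
    by (intro allI Ck_on_Union) (auto simp: smooth_on_def)
  then show ?thesis
    by (rule smooth_on_subset) (use assms in blast)
qed

lemma
  assumes "open S"
  shows smooth_on_const: "smooth_on S (\<lambda>x. c)"
    and smooth_on_bounded_linear: "bounded_linear L \<Longrightarrow> smooth_on S L"
    and smooth_on_add: "smooth_on S f \<Longrightarrow> smooth_on S g \<Longrightarrow> smooth_on S (\<lambda>x. f x + g x)"
  using assms unfolding smooth_on_def
  by (blast intro: Ck_on_const Ck_on_bounded_linear Ck_on_add)+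

lemma
  fixes f g :: "_ \<Rightarrow> 'b::real_normed_field"
  assumes "open S"
  shows smooth_on_mult: "smooth_on S f \<Longrightarrow> smooth_on S g \<Longrightarrow> smooth_on S (\<lambda>x. f x * g x)"
    and smooth_on_inverse: "smooth_on S f \<Longrightarrow> (\<And>x. x \<in> S \<Longrightarrow> f x \<noteq> 0) \<Longrightarrow> smooth_on S (\<lambda>x. inverse (f x))"
  using assms unfolding smooth_on_def
  by (blast intro: Ck_on_mult Ck_on_inverse)+

lemma smooth_on_compose_linear:
  assumes "open S" "bounded_linear L" "L ` S \<subseteq> T" "smooth_on T f"
  shows "smooth_on S (\<lambda>x. f (L x))"
  using assms Ck_on_compose_linear unfolding smooth_on_def by blast

lemma smooth_on_sum:
  assumes "open S" "\<And>i. i \<in> I \<Longrightarrow> smooth_on S (f i)"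
  shows "smooth_on S (\<lambda>x. \<Sum>i\<in>I. f i x)"
  using assms(2)
  by (induction I rule: infinite_finite_induct)
    (auto intro!: smooth_on_const smooth_on_add assms(1))

lemma bounded_linear_of_real_inner: "bounded_linear (\<lambda>x. complex_of_real (\<alpha> \<bullet> x))"
  by (intro bounded_linear_compose[OF bounded_linear_of_real] bounded_linear_inner_right)

lemma smooth_on_of_real_inner: "open S \<Longrightarrow> smooth_on S (\<lambda>x. complex_of_real (\<alpha> \<bullet> x))"
  by (rule smooth_on_bounded_linear[OF _ bounded_linear_of_real_inner])

lemma dir_deriv_cong:
  assumes "open S" "x \<in> S" "\<And>x. x \<in> S \<Longrightarrow> f x = g x" "smooth_on S f"
  shows "dir_deriv v f x = dir_deriv v g x"
  using dir_deriv_eqI[OF has_derivative_transform_within_open[OF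
      smooth_on_has_derivative[OF assms(4,2)] assms(1,2,3)]] by simp

lemma linear_dir_deriv: "smooth_on S f \<Longrightarrow> x \<in> S \<Longrightarrow> linear (\<lambda>v. dir_deriv v f x)"
  by (rule has_derivative_linear[OF smooth_on_has_derivative])

lemma dir_deriv_sum_direction:
  fixes f :: "_ \<Rightarrow> complex"
  assumes "smooth_on S f" "x \<in> S"
  shows "dir_deriv (\<Sum>i\<in>I. c i *\<^sub>R w i) f x = (\<Sum>i\<in>I. of_real (c i) * dir_deriv (w i) f x)"
  using linear_sum[OF linear_dir_deriv[OF assms], of "\<lambda>i. c i *\<^sub>R w i" I]
    linear_scale[OF linear_dir_deriv[OF assms]] by (simp add: scaleR_conv_of_real)

lemma dir_deriv_of_real_inner:
  "dir_deriv v (\<lambda>x. complex_of_real (\<alpha> \<bullet> x)) x = of_real (\<alpha> \<bullet> v)"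
  by (rule dir_deriv_eqI[OF bounded_linear_imp_has_derivative[OF bounded_linear_of_real_inner]])

lemma dir_deriv_add:
  assumes "smooth_on S f" "smooth_on S g" "x \<in> S"
  shows "dir_deriv v (\<lambda>x. f x + g x) x = dir_deriv v f x + dir_deriv v g x"
  by (rule dir_deriv_eqI[OF has_derivative_add]) (rule smooth_on_has_derivative assms)+

lemma dir_deriv_sum:
  assumes "\<And>i. i \<in> I \<Longrightarrow> smooth_on S (f i)" "x \<in> S"
  shows "dir_deriv v (\<lambda>x. \<Sum>i\<in>I. f i x) x = (\<Sum>i\<in>I. dir_deriv v (f i) x)"
  by (rule dir_deriv_eqI[OF has_derivative_sum]) (rule smooth_on_has_derivative assms | assumption)+

lemma dir_deriv_mult:
  fixes f g :: "_ \<Rightarrow> 'b::real_normed_field"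
  assumes "smooth_on S f" "smooth_on S g" "x \<in> S"
  shows "dir_deriv v (\<lambda>x. f x * g x) x = f x * dir_deriv v g x + dir_deriv v f x * g x"
  by (rule dir_deriv_eqI[OF has_derivative_mult]) (rule smooth_on_has_derivative assms)+

lemma dir_deriv_cmult:
  fixes f :: "_ \<Rightarrow> 'b::real_normed_field"
  assumes "smooth_on S f" "x \<in> S"
  shows "dir_deriv v (\<lambda>x. c * f x) x = c * dir_deriv v f x"
  by (rule dir_deriv_eqI[OF has_derivative_mult_right[OF smooth_on_has_derivative[OF assms]]])

lemma dir_deriv_compose_linear:
  assumes "bounded_linear L" "smooth_on S f" "L x \<in> S"
  shows "dir_deriv v (\<lambda>x. f (L x)) x = dir_deriv (L v) f (L x)"
  by (rule dir_deriv_eqI[OF has_derivative_compose[OF bounded_linear_imp_has_derivative[OF assms(1)]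
        smooth_on_has_derivative[OF assms(2,3)]]])

section \<open>The Euler operator\<close>

text \<open>The Euler operator \<open>\<Sum>\<^sub>i x\<^sub>i \<partial>\<^sub>i\<close>, written without coordinates as the derivative in the radial
  direction.\<close>

definition euler_op :: "('a::real_normed_vector \<Rightarrow> 'b::real_normed_vector) \<Rightarrow> 'a \<Rightarrow> 'b"
  where "euler_op f x = dir_deriv x f x"

lemma euler_op_basis:
  fixes f :: "'a::euclidean_space \<Rightarrow> complex"
  assumes "smooth_on S f" "x \<in> S"
  shows "euler_op f x = (\<Sum>b\<in>Basis. of_real (b \<bullet> x) * dir_deriv b f x)"
  unfolding euler_op_def
  using dir_deriv_sum_direction[OF assms, of "\<lambda>b. b \<bullet> x" "\<lambda>b. b" Basis]
  by (simp add: euclidean_representation inner_commute[of _ x])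

lemma smooth_on_euler_op:
  fixes f :: "'a::euclidean_space \<Rightarrow> complex"
  assumes "open S" "smooth_on S f"
  shows "smooth_on S (euler_op f)"
  by (rule smooth_on_cong[OF assms(1) euler_op_basis[symmetric, OF assms(2)]])
    (auto intro!: smooth_on_sum smooth_on_mult smooth_on_of_real_inner smooth_on_dir_deriv assms)

text \<open>Directional derivatives have degree \<open>-1\<close>. The term \<open>dir_deriv v f\<close> comes from differentiating the
  coefficients \<open>b \<bullet> x\<close>; the other one needs the symmetry of second derivatives.\<close>

lemma dir_deriv_euler_op:
  fixes f :: "'a::euclidean_space \<Rightarrow> complex"
  assumes "open S" "smooth_on S f" "x \<in> S"
  shows "dir_deriv v (euler_op f) x = dir_deriv v f x + euler_op (dir_deriv v f) x"
proof -
  note sm = smooth_on_of_real_inner[OF assms(1)] smooth_on_dir_deriv[OF assms(2)]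
  have "dir_deriv v (euler_op f) x = dir_deriv v (\<lambda>x. \<Sum>b\<in>Basis. of_real (b \<bullet> x) * dir_deriv b f x) x"
    by (rule dir_deriv_cong[OF assms(1,3) euler_op_basis[OF assms(2)] smooth_on_euler_op[OF assms(1,2)]])
  also have "\<dots> = (\<Sum>b\<in>Basis. of_real (b \<bullet> x) * dir_deriv v (dir_deriv b f) x + of_real (b \<bullet> v) * dir_deriv b f x)"
    by (simp add: dir_deriv_sum[OF smooth_on_mult[OF assms(1) sm] assms(3)]
      dir_deriv_mult[OF sm assms(3)] dir_deriv_of_real_inner)
  also have "\<dots> = (\<Sum>b\<in>Basis. of_real (b \<bullet> x) * dir_deriv b (dir_deriv v f) x)
      + (\<Sum>b\<in>Basis. of_real (b \<bullet> v) * dir_deriv b f x)"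
    by (simp add: sum.distrib dir_deriv_commute[OF assms, of v])
  also have "(\<Sum>b\<in>Basis. of_real (b \<bullet> v) * dir_deriv b f x) = dir_deriv v f x"
    using dir_deriv_sum_direction[OF assms(2,3), of "\<lambda>b. b \<bullet> v" "\<lambda>b. b" Basis]
    by (simp add: euclidean_representation inner_commute[of _ v])
  finally show ?thesis
    by (simp add: euler_op_basis[OF smooth_on_dir_deriv[OF assms(2)] assms(3)] add.commute)
qed

lemma euler_op_add:
  assumes "smooth_on S f" "smooth_on S g" "x \<in> S"
  shows "euler_op (\<lambda>x. f x + g x) x = euler_op f x + euler_op g x"
  unfolding euler_op_def by (rule dir_deriv_add[OF assms])

lemma euler_op_mult:
  fixes f g :: "_ \<Rightarrow> 'b::real_normed_field"
  assumes "smooth_on S f" "smooth_on S g" "x \<in> S"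
  shows "euler_op (\<lambda>x. f x * g x) x = f x * euler_op g x + euler_op f x * g x"
  unfolding euler_op_def by (rule dir_deriv_mult[OF assms])

section \<open>Reflections and difference quotients\<close>

lemma bounded_linear_reflection: "bounded_linear (reflection \<alpha>)"
proof -
  have "linear (reflection \<alpha>)"
    by (rule linearI) (simp_all add: reflection_def algebra_simps add_divide_distrib scaleR_add_left)
  then show ?thesis by (simp add: linear_conv_bounded_linear)
qed

lemma norm_reflection: "norm (reflection \<alpha> x) = norm x"
proof (cases "\<alpha> = 0")
  case False
  have "(norm (reflection \<alpha> x))\<^sup>2 = (norm x)\<^sup>2"
    using False unfolding reflection_def power2_norm_eq_inner
    by (simp add: inner_diff_left inner_diff_right inner_commute power2_eq_square field_simps)
  then show ?thesis by simp
qed (simp add: reflection_def)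

lemma reflection_eq_0_iff [simp]: "reflection \<alpha> x = 0 \<longleftrightarrow> x = 0"
  using norm_reflection[of \<alpha> x] by (metis norm_eq_zero)

lemma reflection_hyperplane: "\<alpha> \<bullet> x = 0 \<Longrightarrow> reflection \<alpha> x = x"
  by (simp add: reflection_def)

lemma smooth_on_reflection:
  "smooth_on (- {0}) f \<Longrightarrow> smooth_on (- {0}) (\<lambda>x. f (reflection \<alpha> x))"
  by (rule smooth_on_compose_linear[OF _ bounded_linear_reflection]) auto

lemma diff_quotient_off_hyperplane:
  "\<alpha> \<bullet> x \<noteq> 0 \<Longrightarrow> diff_quotient \<alpha> f x = (f x - f (reflection \<alpha> x)) / of_real (\<alpha> \<bullet> x)"
  by (simp add: diff_quotient_def)

text \<open>Integrating the derivative of \<open>f\<close> along the segment from \<open>y\<close> to its mirror image exhibits the factor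
  \<open>\<alpha> \<bullet> y\<close> in \<open>f y - f (reflection \<alpha> y)\<close>, because that segment is proportional to
  \<open>(\<alpha> \<bullet> y) \<alpha>\<close>. The quotient is an integral that still makes sense on the hyperplane. The
  constant weight \<open>1\<close> is kept to match the general form of the segment integrals.\<close>

lemma hadamard_reflection:
  fixes f :: "real ^ 'n \<Rightarrow> complex"
  assumes "smooth_on U f" "convex U" "reflection \<alpha> ` U \<subseteq> U" "y \<in> U"
  shows "f y - f (reflection \<alpha> y) = of_real (\<alpha> \<bullet> y) * (of_real (2 / (norm \<alpha>)\<^sup>2) *
    integral {0..1} (\<lambda>t. 1 *\<^sub>R dir_deriv \<alpha> f ((1 - t) *\<^sub>R y + t *\<^sub>R reflection \<alpha> y)))"
proof -
  let ?p = "\<lambda>t. (1 - t) *\<^sub>R y + t *\<^sub>R reflection \<alpha> y"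
  let ?c = "- (2 * (\<alpha> \<bullet> y) / (norm \<alpha>)\<^sup>2)"
  have pU: "?p t \<in> U" if "t \<in> {0..1}" for t
    using convexD_alt[OF assms(2)] that assms(3,4) by (auto simp: image_subset_iff)
  have "((\<lambda>t. f (?p t)) has_vector_derivative ?c *\<^sub>R dir_deriv \<alpha> f (?p t)) (at t within {0..1})"
    if "t \<in> {0..1}" for t
  proof -
    have line: "((\<lambda>t. y + t *\<^sub>R d) has_derivative (\<lambda>h. h *\<^sub>R d)) (at t within {0..1})" for d
      by (auto intro!: derivative_eq_intros)
    have p: "?p = (\<lambda>t. y + t *\<^sub>R (?c *\<^sub>R \<alpha>))"
      by (auto simp: reflection_def algebra_simps)
    have "(?p has_derivative (\<lambda>h. h *\<^sub>R (?c *\<^sub>R \<alpha>))) (at t within {0..1})"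
      unfolding p by (rule line)
    from has_derivative_compose[OF this smooth_on_has_derivative[OF assms(1) pU[OF that]]]
    show ?thesis
      unfolding has_vector_derivative_def
      by (simp add: linear_scale[OF linear_dir_deriv[OF assms(1) pU[OF that]]] del: scaleR_minus_left)
  qed
  from fundamental_theorem_of_calculus[OF zero_le_one this]
  have "((\<lambda>t. ?c *\<^sub>R dir_deriv \<alpha> f (?p t)) has_integral f (reflection \<alpha> y) - f y) {0..1}"
    by (simp del: scaleR_minus_left)
  from integral_unique[OF this]
  have "f (reflection \<alpha> y) - f y = ?c *\<^sub>R integral {0..1} (\<lambda>t. dir_deriv \<alpha> f (?p t))"
    by (simp only: integral_cmul)
  then show ?thesis
    by (simp add: scaleR_conv_of_real algebra_simps)
qed

text \<open>The difference quotient is characterised by the equation obtained by clearing the denominator: off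
  the hyperplane the equation can be divided by \<open>\<alpha> \<bullet> y\<close>, and on the hyperplane both sides are limits
  of values off it. With this rule, no identity for difference quotients needs a separate
  treatment of the hyperplane.\<close>

lemma diff_quotient_eqI:
  assumes "open S" "x \<in> S" "\<alpha> \<noteq> 0" "continuous_on S g"
    and eq: "\<And>y. y \<in> S \<Longrightarrow> of_real (\<alpha> \<bullet> y) * g y = f y - f (reflection \<alpha> y)"
  shows "diff_quotient \<alpha> f x = g x"
proof -
  have quot: "(f y - f (reflection \<alpha> y)) / of_real (\<alpha> \<bullet> y) = g y" if "y \<in> S" "\<alpha> \<bullet> y \<noteq> 0" for y
    using eq[OF that(1), symmetric] that(2) by simp
  show ?thesis
  proof (cases "\<alpha> \<bullet> x = 0")
    case True
    let ?H = "{y. \<alpha> \<bullet> y \<noteq> 0}"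
    have "x islimpt ?H"
      unfolding islimpt_approachable
    proof (intro allI impI)
      fix e :: real assume "e > 0"
      let ?y = "x + (e / (2 * norm \<alpha>)) *\<^sub>R \<alpha>"
      have "?y \<in> ?H" "?y \<noteq> x" "dist ?y x < e"
        using \<open>e > 0\<close> assms(3) True by (auto simp: inner_add_right dist_norm)
      then show "\<exists>x'\<in>?H. x' \<noteq> x \<and> dist x' x < e" by blast
    qed
    then have nt: "at x within ?H \<noteq> bot"
      by (simp add: trivial_limit_within)
    have "isCont g x"
      using assms(1,2,4) by (simp add: continuous_on_eq_continuous_at)
    then have "(g \<longlongrightarrow> g x) (at x within ?H)"
      by (simp add: continuous_at_imp_continuous_at_within continuous_within[symmetric])
    moreover have "\<forall>\<^sub>F z in at x within ?H. g z = (f z - f (reflection \<alpha> z)) / of_real (\<alpha> \<bullet> z)"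
      using quot assms(1,2) unfolding eventually_at_topological by (auto intro!: exI[of _ S])
    ultimately have "((\<lambda>z. (f z - f (reflection \<alpha> z)) / of_real (\<alpha> \<bullet> z)) \<longlongrightarrow> g x) (at x within ?H)"
      by (rule Lim_transform_eventually)
    from tendsto_Lim[OF nt this] show ?thesis
      using True by (simp add: diff_quotient_def)
  qed (use quot assms(2) in \<open>simp add: diff_quotient_off_hyperplane\<close>)
qed

lemma times_diff_quotient: "of_real (\<alpha> \<bullet> x) * diff_quotient \<alpha> f x = f x - f (reflection \<alpha> x)"
  by (cases "\<alpha> \<bullet> x = 0") (simp_all add: diff_quotient_off_hyperplane reflection_hyperplane)

text \<open>The ball around \<open>x\<close> of radius \<open>norm x\<close> is convex, misses the origin and is mapped to itself by the
  reflection, since this is an isometry that fixes the centre \<open>x\<close>. On it the segment integral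
  is therefore defined and smooth.\<close>

lemma diff_quotient_smooth_near_hyperplane:
  fixes f :: "real ^ 'n \<Rightarrow> complex"
  assumes "smooth_on (- {0}) f" "\<alpha> \<noteq> 0" "x \<noteq> 0" "\<alpha> \<bullet> x = 0"
  shows "\<exists>U. open U \<and> x \<in> U \<and> smooth_on U (diff_quotient \<alpha> f)"
proof -
  let ?r = "reflection \<alpha>"
  define U where "U = ball x (norm x)"
  have U: "open U" "convex U" "x \<in> U" "U \<subseteq> - {0}"
    using assms(3) by (auto simp: U_def)
  have rU: "?r ` U \<subseteq> U"
  proof -
    have "dist x (?r y) = dist x y" for y
    proof -
      have "dist x (?r y) = norm (?r (x - y))"
        using linear_diff[OF bounded_linear.linear[OF bounded_linear_reflection], of \<alpha> x y]
        by (simp add: dist_norm reflection_hyperplane[OF assms(4)])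
      then show ?thesis by (simp add: norm_reflection dist_norm)
    qed
    then show ?thesis by (auto simp: U_def)
  qed
  have fU: "smooth_on U f" by (rule smooth_on_subset[OF assms(1) U(4)])
  define G where "G y = complex_of_real (2 / (norm \<alpha>)\<^sup>2) *
    integral {0..1} (\<lambda>t. 1 *\<^sub>R dir_deriv \<alpha> f ((1 - t) *\<^sub>R y + t *\<^sub>R ?r y))" for y
  have GU: "smooth_on U G"
    unfolding G_def[abs_def]
  proof (rule smooth_on_mult[OF U(1) smooth_on_const[OF U(1)]])
    show "smooth_on U (\<lambda>y. integral {0..1} (\<lambda>t. 1 *\<^sub>R dir_deriv \<alpha> f ((1 - t) *\<^sub>R y + t *\<^sub>R ?r y)))"
      using smooth_on_dir_deriv[OF fU, of \<alpha>] unfolding smooth_on_def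
      by (intro allI Ck_on_segment_integral[OF U(1,2) bounded_linear_reflection rU]
        continuous_on_const) auto
  qed
  have "diff_quotient \<alpha> f y = G y" if "y \<in> U" for y
    by (rule diff_quotient_eqI[OF U(1) that assms(2) smooth_on_continuous[OF GU]])
      (simp only: G_def hadamard_reflection[OF fU U(2) rU])
  then show ?thesis
    using U smooth_on_cong[OF U(1) _ GU] by metis
qed

lemma smooth_on_diff_quotient:
  fixes f :: "real ^ 'n \<Rightarrow> complex"
  assumes "smooth_on (- {0}) f" "\<alpha> \<noteq> 0"
  shows "smooth_on (- {0}) (diff_quotient \<alpha> f)"
proof (rule smooth_on_local)
  fix x :: "real ^ 'n" assume x: "x \<in> - {0}"
  show "\<exists>U. open U \<and> x \<in> U \<and> smooth_on U (diff_quotient \<alpha> f)"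
  proof (cases "\<alpha> \<bullet> x = 0")
    case True
    with diff_quotient_smooth_near_hyperplane[OF assms] x show ?thesis by simp
  next
    case False
    let ?U = "{y. \<alpha> \<bullet> y \<noteq> 0}"
    have U: "open ?U" by (intro open_Collect_neq continuous_intros)
    have sub: "?U \<subseteq> - {0}" by auto
    have "smooth_on ?U (\<lambda>y. (f y + (- 1) * f (reflection \<alpha> y)) * inverse (of_real (\<alpha> \<bullet> y)))"
      by (intro smooth_on_mult smooth_on_add smooth_on_inverse smooth_on_const smooth_on_of_real_inner U
          smooth_on_subset[OF assms(1) sub] smooth_on_subset[OF smooth_on_reflection[OF assms(1)] sub])
        simp
    then have "smooth_on ?U (diff_quotient \<alpha> f)"
      by (rule smooth_on_cong[OF U, rotated]) (simp add: diff_quotient_off_hyperplane divide_inverse)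
    then show ?thesis using U False by blast
  qed
qed

context
  fixes \<alpha> :: "real ^ 'n" and f :: "real ^ 'n \<Rightarrow> complex"
  assumes \<alpha>: "\<alpha> \<noteq> 0" and f: "smooth_on (- {0}) f"
begin

private lemmas continuous_dq = smooth_on_continuous[OF smooth_on_diff_quotient[OF f \<alpha>]]

lemma diff_quotient_cong:
  assumes "\<And>y. y \<noteq> 0 \<Longrightarrow> f y = g y" "x \<noteq> 0"
  shows "diff_quotient \<alpha> g x = diff_quotient \<alpha> f x"
  by (rule diff_quotient_eqI[of "- {0}", OF _ _ \<alpha> continuous_dq])
    (use assms in \<open>auto simp: times_diff_quotient\<close>)

lemma diff_quotient_add:
  assumes "smooth_on (- {0}) g" "x \<noteq> 0"
  shows "diff_quotient \<alpha> (\<lambda>y. f y + g y) x = diff_quotient \<alpha> f x + diff_quotient \<alpha> g x"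
  by (rule diff_quotient_eqI[of "- {0}", OF _ _ \<alpha>
      continuous_on_add[OF continuous_dq smooth_on_continuous[OF smooth_on_diff_quotient[OF assms(1) \<alpha>]]]])
    (use assms(2) in \<open>auto simp: times_diff_quotient distrib_left\<close>)

lemma diff_quotient_mult_invariant:
  assumes "continuous_on (- {0}) \<phi>" "\<And>y. \<phi> (reflection \<alpha> y) = \<phi> y" "x \<noteq> 0"
  shows "diff_quotient \<alpha> (\<lambda>y. \<phi> y * f y) x = \<phi> x * diff_quotient \<alpha> f x"
  by (rule diff_quotient_eqI[of "- {0}", OF _ _ \<alpha> continuous_on_mult[OF assms(1) continuous_dq]])
    (use assms(2,3) in \<open>auto simp: times_diff_quotient mult.left_commute right_diff_distrib\<close>)

text \<open>A linear factor is not invariant under the reflection; the defect \<open>2 (\<alpha> \<bullet> \<xi>) / (norm \<alpha>)\<^sup>2\<close> of invariance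
  multiplies the reflected function. In the Laplacian these terms will cancel the reflected values of
  \<open>f\<close> that come from the difference quotients.\<close>

lemma diff_quotient_mult_inner:
  assumes "x \<noteq> 0"
  shows "diff_quotient \<alpha> (\<lambda>y. of_real (\<xi> \<bullet> y) * f y) x = of_real (\<xi> \<bullet> x) * diff_quotient \<alpha> f x
    + of_real (2 * (\<alpha> \<bullet> \<xi>) / (norm \<alpha>)\<^sup>2) * f (reflection \<alpha> x)"
proof (rule diff_quotient_eqI[of "- {0}", OF _ _ \<alpha>])
  show "continuous_on (- {0}) (\<lambda>x. of_real (\<xi> \<bullet> x) * diff_quotient \<alpha> f x
    + of_real (2 * (\<alpha> \<bullet> \<xi>) / (norm \<alpha>)\<^sup>2) * f (reflection \<alpha> x))"
    by (intro continuous_intros continuous_dq smooth_on_continuous[OF smooth_on_reflection[OF f]])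
next
  fix y
  have "complex_of_real (\<xi> \<bullet> reflection \<alpha> y) =
      of_real (\<xi> \<bullet> y) - of_real (\<alpha> \<bullet> y) * of_real (2 * (\<alpha> \<bullet> \<xi>) / (norm \<alpha>)\<^sup>2)"
    by (simp add: reflection_def inner_diff_right inner_commute[of \<xi> \<alpha>])
  then show "of_real (\<alpha> \<bullet> y) * (of_real (\<xi> \<bullet> y) * diff_quotient \<alpha> f y
      + of_real (2 * (\<alpha> \<bullet> \<xi>) / (norm \<alpha>)\<^sup>2) * f (reflection \<alpha> y))
    = of_real (\<xi> \<bullet> y) * f y - of_real (\<xi> \<bullet> reflection \<alpha> y) * f (reflection \<alpha> y)"
    by (simp only: distrib_left mult.left_commute[of "of_real (\<alpha> \<bullet> y)" "of_real (\<xi> \<bullet> y)"]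
        times_diff_quotient) (simp add: algebra_simps)
qed (use assms in auto)

text \<open>The difference quotient lowers the degree by one: apply the Euler operator, a derivation that
  commutes with the reflection and fixes the linear form \<open>\<alpha> \<bullet> y\<close>, to
  \<open>(\<alpha> \<bullet> y) * diff_quotient \<alpha> f y = f y - f (reflection \<alpha> y)\<close>.\<close>

lemma diff_quotient_euler_op:
  assumes "x \<noteq> 0"
  shows "diff_quotient \<alpha> (euler_op f) x = euler_op (diff_quotient \<alpha> f) x + diff_quotient \<alpha> f x"
proof (rule diff_quotient_eqI[of "- {0}", OF _ _ \<alpha>])
  note dq = smooth_on_diff_quotient[OF f \<alpha>]
  have op: "open (- {0 :: real ^ 'n})" by auto
  note inner = smooth_on_of_real_inner[OF op, of \<alpha>]
  show "continuous_on (- {0}) (\<lambda>x. euler_op (diff_quotient \<alpha> f) x + diff_quotient \<alpha> f x)"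
    by (rule smooth_on_continuous[OF smooth_on_add[OF op smooth_on_euler_op[OF op dq] dq]])
  fix y :: "real ^ 'n" assume y: "y \<in> - {0}"
  have "euler_op (\<lambda>y. of_real (\<alpha> \<bullet> y) * diff_quotient \<alpha> f y) y =
      of_real (\<alpha> \<bullet> y) * (euler_op (diff_quotient \<alpha> f) y + diff_quotient \<alpha> f y)"
    by (subst euler_op_mult[OF inner dq y])
      (simp add: euler_op_def dir_deriv_of_real_inner distrib_left)
  moreover have "euler_op (\<lambda>y. f y + (- 1) * f (reflection \<alpha> y)) y =
      euler_op f y - euler_op f (reflection \<alpha> y)"
    using euler_op_add[OF f smooth_on_mult[OF op smooth_on_const[OF op, of "- 1"] smooth_on_reflection[OF f]] y]
      dir_deriv_cmult[OF smooth_on_reflection[OF f] y, of y "-1"]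
      dir_deriv_compose_linear[OF bounded_linear_reflection f, of \<alpha> y y] y
    by (simp add: euler_op_def)
  ultimately show "of_real (\<alpha> \<bullet> y) * (euler_op (diff_quotient \<alpha> f) y + diff_quotient \<alpha> f y)
      = euler_op f y - euler_op f (reflection \<alpha> y)"
    by (simp add: times_diff_quotient)
qed (use assms in auto)

end

section \<open>Powers of the norm\<close>

definition norm_powr :: "complex \<Rightarrow> 'a::real_normed_vector \<Rightarrow> complex"
  where "norm_powr a x = of_real (norm x) powr a"

lemma norm_powr_add: "norm_powr (a + b) x = norm_powr a x * norm_powr b x"
  by (simp add: norm_powr_def powr_add)

lemma norm_powr_0: "x \<noteq> 0 \<Longrightarrow> norm_powr 0 x = 1"
  by (simp add: norm_powr_def)

lemma norm_powr_2: "norm_powr 2 x = of_real ((norm x)\<^sup>2)"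
  using powr_nat'[of "complex_of_real (norm x)" 2] by (simp add: norm_powr_def)

lemma norm_powr_reflection: "norm_powr a (reflection \<alpha> x) = norm_powr a x"
  by (simp add: norm_powr_def norm_reflection)

text \<open>The derivative is again a power of the norm times a linear form, so that smoothness of all powers
  follows by one induction over \<open>n\<close> with arbitrary exponent.\<close>

lemma norm_powr_has_derivative:
  fixes x :: "'a::real_inner"
  assumes "x \<noteq> 0"
  shows "(norm_powr a has_derivative (\<lambda>v. a * of_real (x \<bullet> v) * norm_powr (a - 2) x)) (at x)"
proof -
  have pow: "norm_powr b y = exp (b * of_real (ln (norm y)))" if "y \<noteq> 0" for y :: 'a and b
    using that by (simp add: norm_powr_def powr_def Ln_of_real)
  have "((\<lambda>y. ln (norm y)) has_derivative (\<lambda>v. (sgn x \<bullet> v) / norm x)) (at x)"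
    using has_derivative_ln[OF _ has_derivative_norm[OF assms]] assms
    by (simp add: divide_inverse mult.commute inner_commute)
  from has_derivative_compose[OF has_derivative_mult_right[OF has_derivative_of_real[OF this], of a]
      DERIV_exp[unfolded has_field_derivative_def]]
  have "((\<lambda>y. exp (a * of_real (ln (norm y)))) has_derivative
      (\<lambda>v. a * of_real (sgn x \<bullet> v / norm x) * exp (a * of_real (ln (norm x))))) (at x)"
    by (simp add: mult.commute)
  then have "(norm_powr a has_derivative
      (\<lambda>v. a * of_real (sgn x \<bullet> v / norm x) * exp (a * of_real (ln (norm x))))) (at x)"
    by (rule has_derivative_transform_within_open[of _ _ _ _ "- {0}"]) (use assms in \<open>auto simp: pow\<close>)
  moreover have "norm_powr a x = norm_powr (a - 2) x * of_real ((norm x)\<^sup>2)"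
    using norm_powr_add[of "a - 2" 2 x] by (simp add: norm_powr_2)
  then have "a * of_real (sgn x \<bullet> v / norm x) * exp (a * of_real (ln (norm x)))
      = a * of_real (x \<bullet> v) * norm_powr (a - 2) x" for v
    using assms by (simp add: pow[symmetric] sgn_div_norm field_simps power2_eq_square)
  ultimately show ?thesis by simp
qed

lemma dir_deriv_norm_powr:
  "x \<noteq> 0 \<Longrightarrow> dir_deriv v (norm_powr a) x = a * of_real (x \<bullet> v) * norm_powr (a - 2) x"
  by (rule dir_deriv_eqI[OF norm_powr_has_derivative])

lemma smooth_on_norm_powr: "smooth_on (- {0 :: 'a::real_inner}) (norm_powr a)"
proof -
  have "Ck_on n (- {0 :: 'a}) (norm_powr a)" for n
  proof (induction n arbitrary: a)
    case 0
    then show ?case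
      using has_derivative_continuous[OF norm_powr_has_derivative]
      by (auto intro!: continuous_at_imp_continuous_on)
  next
    case (Suc n)
    have op: "open (- {0 :: 'a})" by auto
    show ?case
    proof (rule Ck_on_SucI[OF op norm_powr_has_derivative])
      have "(\<lambda>x. of_real (x \<bullet> v)) = (\<lambda>x. complex_of_real (v \<bullet> x))" for v :: 'a
        by (simp add: inner_commute)
      then show "Ck_on n (- {0 :: 'a}) (\<lambda>x. a * of_real (x \<bullet> v) * norm_powr (a - 2) x)" for v
        by (intro Ck_on_mult op Ck_on_const Suc)
          (simp add: Ck_on_bounded_linear bounded_linear_of_real_inner op)
    qed auto
  qed
  then show ?thesis by (simp add: smooth_on_def)
qed

lemma euler_op_norm_powr: "x \<noteq> 0 \<Longrightarrow> euler_op (norm_powr a) x = a * norm_powr a x"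
  for x :: "'a::real_inner"
  using norm_powr_add[of "a - 2" 2 x]
  by (simp add: euler_op_def dir_deriv_norm_powr norm_powr_2 power2_norm_eq_inner)

section \<open>Dunkl operators\<close>

lemma open_punctured: "open (- {0 :: real ^ 'n})"
  by auto

lemma dunkl_op_eq: "dunkl_op Rp k \<xi> f x = dir_deriv \<xi> f x +
    (\<Sum>\<alpha>\<in>Rp. k \<alpha> * of_real (\<alpha> \<bullet> \<xi>) * diff_quotient \<alpha> f x)"
  by (simp add: dunkl_op_def dir_deriv_def)

context
  fixes Rp :: "(real ^ 'n) set" and k :: "real ^ 'n \<Rightarrow> complex"
  assumes Rp: "0 \<notin> Rp"
begin

private lemma root_nonzero: "\<alpha> \<in> Rp \<Longrightarrow> \<alpha> \<noteq> 0"
  using Rp by auto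

lemma smooth_on_dunkl_op:
  assumes "smooth_on (- {0}) f"
  shows "smooth_on (- {0}) (dunkl_op Rp k \<xi> f)"
  unfolding dunkl_op_eq[abs_def]
  by (intro smooth_on_add smooth_on_sum smooth_on_mult smooth_on_const smooth_on_diff_quotient
      smooth_on_dir_deriv assms open_punctured root_nonzero)

lemma dunkl_op_cong:
  assumes "smooth_on (- {0}) f" "\<And>y. y \<noteq> 0 \<Longrightarrow> f y = g y" "x \<noteq> 0"
  shows "dunkl_op Rp k \<xi> f x = dunkl_op Rp k \<xi> g x"
proof -
  have "dir_deriv \<xi> f x = dir_deriv \<xi> g x"
    by (rule dir_deriv_cong[OF open_punctured _ _ assms(1)]) (use assms in auto)
  then show ?thesis
    unfolding dunkl_op_eq by (simp add: diff_quotient_cong[OF root_nonzero assms] cong: sum.cong)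
qed

lemma dunkl_op_add:
  assumes "smooth_on (- {0}) f" "smooth_on (- {0}) g" "x \<noteq> 0"
  shows "dunkl_op Rp k \<xi> (\<lambda>y. f y + g y) x = dunkl_op Rp k \<xi> f x + dunkl_op Rp k \<xi> g x"
proof -
  have "dir_deriv \<xi> (\<lambda>y. f y + g y) x = dir_deriv \<xi> f x + dir_deriv \<xi> g x"
    by (rule dir_deriv_add[OF assms(1,2)]) (use assms in auto)
  then show ?thesis
    unfolding dunkl_op_eq
    by (simp add: diff_quotient_add[OF root_nonzero assms] distrib_left sum.distrib cong: sum.cong)
qed

text \<open>For radial functions a Dunkl operator obeys the product rule with the ordinary derivative, because
  the difference quotients commute with multiplication by an invariant function.\<close>

lemma dunkl_op_norm_powr:
  assumes "smooth_on (- {0}) f" "x \<noteq> 0"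
  shows "dunkl_op Rp k \<xi> (\<lambda>y. norm_powr b y * f y) x =
    b * of_real (\<xi> \<bullet> x) * norm_powr (b - 2) x * f x + norm_powr b x * dunkl_op Rp k \<xi> f x"
proof -
  have "dir_deriv \<xi> (\<lambda>y. norm_powr b y * f y) x =
      norm_powr b x * dir_deriv \<xi> f x + b * of_real (\<xi> \<bullet> x) * norm_powr (b - 2) x * f x"
    using assms(2)
    by (subst dir_deriv_mult[OF smooth_on_norm_powr assms(1)])
      (auto simp: dir_deriv_norm_powr inner_commute)
  moreover have "diff_quotient \<alpha> (\<lambda>y. norm_powr b y * f y) x = norm_powr b x * diff_quotient \<alpha> f x"
    if "\<alpha> \<in> Rp" for \<alpha>
    by (rule diff_quotient_mult_invariant[OF root_nonzero[OF that] assms(1)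
        smooth_on_continuous[OF smooth_on_norm_powr] norm_powr_reflection assms(2)])
  ultimately show ?thesis
    unfolding dunkl_op_eq
    by (simp add: distrib_left sum_distrib_left mult_ac cong: sum.cong)
qed

lemma dunkl_op_cmult:
  assumes "smooth_on (- {0}) f" "x \<noteq> 0"
  shows "dunkl_op Rp k \<xi> (\<lambda>y. c * f y) x = c * dunkl_op Rp k \<xi> f x"
proof -
  have "dir_deriv \<xi> (\<lambda>y. c * f y) x = c * dir_deriv \<xi> f x"
    by (rule dir_deriv_cmult[OF assms(1)]) (use assms in auto)
  moreover have "diff_quotient \<alpha> (\<lambda>y. c * f y) x = c * diff_quotient \<alpha> f x" if "\<alpha> \<in> Rp" for \<alpha>
    by (rule diff_quotient_mult_invariant[OF root_nonzero[OF that] assms(1) continuous_on_const refl assms(2)])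
  ultimately show ?thesis
    unfolding dunkl_op_eq
    by (simp add: distrib_left sum_distrib_left mult_ac cong: sum.cong)
qed

lemma dunkl_op_mult_inner:
  assumes "smooth_on (- {0}) f" "x \<noteq> 0"
  shows "dunkl_op Rp k \<xi> (\<lambda>y. of_real (\<eta> \<bullet> y) * f y) x =
    of_real (\<eta> \<bullet> \<xi>) * f x + of_real (\<eta> \<bullet> x) * dunkl_op Rp k \<xi> f x +
    (\<Sum>\<alpha>\<in>Rp. k \<alpha> * of_real (2 * (\<alpha> \<bullet> \<xi>) * (\<alpha> \<bullet> \<eta>) / (norm \<alpha>)\<^sup>2) * f (reflection \<alpha> x))"
proof -
  have "dir_deriv \<xi> (\<lambda>y. of_real (\<eta> \<bullet> y) * f y) x =
      of_real (\<eta> \<bullet> x) * dir_deriv \<xi> f x + of_real (\<eta> \<bullet> \<xi>) * f x"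
    using assms(2)
    by (subst dir_deriv_mult[OF smooth_on_of_real_inner[OF open_punctured] assms(1)])
      (auto simp: dir_deriv_of_real_inner)
  moreover have "k \<alpha> * of_real (\<alpha> \<bullet> \<xi>) * diff_quotient \<alpha> (\<lambda>y. of_real (\<eta> \<bullet> y) * f y) x =
      of_real (\<eta> \<bullet> x) * (k \<alpha> * of_real (\<alpha> \<bullet> \<xi>) * diff_quotient \<alpha> f x) +
      k \<alpha> * of_real (2 * (\<alpha> \<bullet> \<xi>) * (\<alpha> \<bullet> \<eta>) / (norm \<alpha>)\<^sup>2) * f (reflection \<alpha> x)" if "\<alpha> \<in> Rp" for \<alpha>
    unfolding diff_quotient_mult_inner[OF root_nonzero[OF that] assms] by (simp add: algebra_simps)
  ultimately show ?thesis
    unfolding dunkl_op_eq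
    by (simp add: distrib_left sum_distrib_left sum.distrib add_ac cong: sum.cong)
qed

lemma dunkl_op_euler_op:
  assumes "smooth_on (- {0}) f" "x \<noteq> 0"
  shows "dunkl_op Rp k \<xi> (euler_op f) x = euler_op (dunkl_op Rp k \<xi> f) x + dunkl_op Rp k \<xi> f x"
proof -
  have x: "x \<in> - {0}" using assms(2) by simp
  note dq = smooth_on_diff_quotient[OF assms(1) root_nonzero]
  note summand = smooth_on_mult[OF open_punctured smooth_on_const[OF open_punctured] dq]
  have "euler_op (dunkl_op Rp k \<xi> f) x = euler_op (dir_deriv \<xi> f) x +
      (\<Sum>\<alpha>\<in>Rp. k \<alpha> * of_real (\<alpha> \<bullet> \<xi>) * euler_op (diff_quotient \<alpha> f) x)"
    unfolding dunkl_op_eq[abs_def] euler_op_def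
    by (subst dir_deriv_add[OF smooth_on_dir_deriv[OF assms(1)]
          smooth_on_sum[OF open_punctured summand] x], assumption,
        subst dir_deriv_sum[OF summand x], assumption)
      (simp add: dir_deriv_cmult[OF dq x] cong: sum.cong)
  then show ?thesis
    unfolding dunkl_op_eq dir_deriv_euler_op[OF open_punctured assms(1) x]
    by (simp add: diff_quotient_euler_op[OF root_nonzero assms] distrib_left sum.distrib cong: sum.cong)
qed

lemma smooth_on_dunkl_laplacian:
  assumes "smooth_on (- {0}) f"
  shows "smooth_on (- {0}) (dunkl_laplacian \<xi> Rp k f)"
  unfolding dunkl_laplacian_def[abs_def]
  by (intro smooth_on_sum smooth_on_dunkl_op assms open_punctured)

lemma dunkl_laplacian_cong:
  assumes "smooth_on (- {0}) f" "\<And>y. y \<noteq> 0 \<Longrightarrow> f y = g y" "x \<noteq> 0"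
  shows "dunkl_laplacian \<xi> Rp k f x = dunkl_laplacian \<xi> Rp k g x"
  unfolding dunkl_laplacian_def
  by (intro sum.cong refl dunkl_op_cong smooth_on_dunkl_op assms)

lemma dunkl_laplacian_add:
  assumes f: "smooth_on (- {0}) f" and g: "smooth_on (- {0}) g" and x: "x \<noteq> 0"
  shows "dunkl_laplacian \<xi> Rp k (\<lambda>y. f y + g y) x =
    dunkl_laplacian \<xi> Rp k f x + dunkl_laplacian \<xi> Rp k g x"
proof -
  let ?T = "\<lambda>j. dunkl_op Rp k (\<xi> j)"
  have "?T j (?T j (\<lambda>y. f y + g y)) x = ?T j (\<lambda>y. ?T j f y + ?T j g y) x" for j
    by (rule dunkl_op_cong) (auto intro: smooth_on_dunkl_op smooth_on_add open_punctured f g dunkl_op_add simp: x)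
  also have "\<dots> j = ?T j (?T j f) x + ?T j (?T j g) x" for j
    by (intro dunkl_op_add smooth_on_dunkl_op f g x)
  finally show ?thesis by (simp add: dunkl_laplacian_def sum.distrib)
qed

lemma dunkl_laplacian_cmult:
  assumes f: "smooth_on (- {0}) f" and x: "x \<noteq> 0"
  shows "dunkl_laplacian \<xi> Rp k (\<lambda>y. c * f y) x = c * dunkl_laplacian \<xi> Rp k f x"
proof -
  let ?T = "\<lambda>j. dunkl_op Rp k (\<xi> j)"
  have "?T j (?T j (\<lambda>y. c * f y)) x = ?T j (\<lambda>y. c * ?T j f y) x" for j
    by (rule dunkl_op_cong[OF smooth_on_dunkl_op[OF
        smooth_on_mult[OF open_punctured smooth_on_const[OF open_punctured] f]] dunkl_op_cmult[OF f] x])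
  also have "\<dots> j = c * ?T j (?T j f) x" for j
    by (intro dunkl_op_cmult smooth_on_dunkl_op f x)
  finally show ?thesis by (simp add: dunkl_laplacian_def sum_distrib_left)
qed

lemma dunkl_laplacian_euler_op:
  assumes f: "smooth_on (- {0}) f" and x: "x \<noteq> 0"
  shows "dunkl_laplacian \<xi> Rp k (euler_op f) x =
    euler_op (dunkl_laplacian \<xi> Rp k f) x + 2 * dunkl_laplacian \<xi> Rp k f x"
proof -
  let ?T = "\<lambda>j. dunkl_op Rp k (\<xi> j)"
  note Tf = smooth_on_dunkl_op[OF f]
  note TTf = smooth_on_dunkl_op[OF Tf]
  have "?T j (?T j (euler_op f)) x = ?T j (\<lambda>y. euler_op (?T j f) y + ?T j f y) x" for j
    by (rule dunkl_op_cong)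
      (auto intro: smooth_on_dunkl_op smooth_on_euler_op open_punctured f dunkl_op_euler_op simp: x)
  also have "\<dots> j = ?T j (euler_op (?T j f)) x + ?T j (?T j f) x" for j
    by (intro dunkl_op_add smooth_on_euler_op open_punctured Tf x)
  also have "\<dots> j = euler_op (?T j (?T j f)) x + 2 * ?T j (?T j f) x" for j
    by (simp add: dunkl_op_euler_op[OF Tf x])
  moreover have "euler_op (dunkl_laplacian \<xi> Rp k f) x = (\<Sum>j\<in>UNIV. euler_op (?T j (?T j f)) x)"
    unfolding dunkl_laplacian_def[abs_def] euler_op_def
    by (rule dir_deriv_sum[OF TTf]) (use x in simp)
  ultimately show ?thesis
    by (simp add: dunkl_laplacian_def sum.distrib sum_distrib_left)
qed

end

text \<open>The matrix with rows \<open>\<xi> j\<close> is orthogonal, and a one-sided inverse of a square matrix is two-sided.\<close>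

lemma orthonormal_basis_expansion:
  fixes \<xi> :: "'n \<Rightarrow> real ^ 'n"
  assumes "orthonormal_basis \<xi>"
  shows "(\<Sum>j\<in>UNIV. (\<xi> j \<bullet> v) *\<^sub>R \<xi> j) = v"
proof -
  define A where "A = (\<chi> i. \<xi> i)"
  have "A ** transpose A = mat 1"
    using assms by (simp add: A_def orthonormal_basis_def matrix_matrix_mult_def transpose_def
        mat_def vec_eq_iff inner_vec_def)
  then have A: "transpose A ** A = mat 1"
    by (simp add: matrix_left_right_inverse)
  have "(\<Sum>j\<in>UNIV. (\<xi> j \<bullet> v) *\<^sub>R \<xi> j) = transpose A *v (A *v v)"
    by (simp add: vec_eq_iff A_def matrix_vector_mult_def transpose_def inner_vec_def mult.commute)
  also have "\<dots> = v"
    by (simp add: matrix_vector_mul_assoc A)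
  finally show ?thesis .
qed

lemma orthonormal_basis_parseval:
  assumes "orthonormal_basis \<xi>"
  shows "(\<Sum>j\<in>UNIV. (\<xi> j \<bullet> v) * (\<xi> j \<bullet> w)) = v \<bullet> w"
proof -
  have "v \<bullet> w = (\<Sum>j\<in>UNIV. (\<xi> j \<bullet> v) *\<^sub>R \<xi> j) \<bullet> w"
    by (simp add: orthonormal_basis_expansion[OF assms])
  then show ?thesis by (simp add: inner_sum_left)
qed

text \<open>The central computation. Two applications of the product rule for powers of the norm
  leave the sums over the basis of \<open>(\<xi>\<^sub>j \<bullet> x)\<^sup>2\<close>, of \<open>T\<^sub>j\<close> applied to \<open>(\<xi>\<^sub>j \<bullet> y) f\<close> and of
  \<open>(\<xi>\<^sub>j \<bullet> x) T\<^sub>j f\<close>. By Parseval's identity the first is \<open>(norm x)\<^sup>2\<close>, and the other two contain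
  the reflected values \<open>\<Sum>\<^sub>\<alpha> k\<^sub>\<alpha> f (r\<^sub>\<alpha> x)\<close> with coefficients that cancel: the second contributes
  \<open>+2\<close> of them besides a copy of the third, and the third \<open>-1\<close> each time it occurs, which is twice.
  What remains of the difference part is multiplication by \<open>2 \<langle>k\<rangle>\<close>.\<close>

lemma dunkl_laplacian_norm_powr:
  fixes f :: "real ^ 'n \<Rightarrow> complex"
  assumes Rp: "0 \<notin> Rp" and \<xi>: "orthonormal_basis \<xi>"
    and f: "smooth_on (- {0}) f" and x: "x \<noteq> 0"
  shows "dunkl_laplacian \<xi> Rp k (\<lambda>y. norm_powr a y * f y) x =
    norm_powr a x * dunkl_laplacian \<xi> Rp k f x + a * norm_powr (a - 2) x *
    ((of_nat CARD('n) + 2 * (\<Sum>\<alpha>\<in>Rp. k \<alpha>) + a - 2) * f x + 2 * euler_op f x)"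
proof -
  let ?T = "\<lambda>j. dunkl_op Rp k (\<xi> j)" and ?l = "\<lambda>j y. complex_of_real (\<xi> j \<bullet> y)"
  let ?p = "\<lambda>b y. norm_powr b y :: complex"
  let ?F = "\<Sum>\<alpha>\<in>Rp. k \<alpha> * f (reflection \<alpha> x)"
  note op = open_punctured
  note Tf = smooth_on_dunkl_op[OF Rp f]
  note lf = smooth_on_mult[OF op smooth_on_of_real_inner[OF op] f]
  have parseval: "(\<Sum>j\<in>UNIV. ?l j v * ?l j w) = of_real (v \<bullet> w)" for v w
    using orthonormal_basis_parseval[OF \<xi>, of v w] by (simp flip: of_real_mult of_real_sum)
  have second: "?T j (?T j (\<lambda>y. ?p a y * f y)) x =
      a * (a - 2) * ?p (a - 4) x * f x * (?l j x * ?l j x) + a * ?p (a - 2) x * ?T j (\<lambda>y. ?l j y * f y) x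
      + a * ?p (a - 2) x * (?l j x * ?T j f x) + ?p a x * ?T j (?T j f) x" for j
  proof -
    have "?T j (?T j (\<lambda>y. ?p a y * f y)) x =
        ?T j (\<lambda>y. a * (?p (a - 2) y * (?l j y * f y)) + ?p a y * ?T j f y) x"
      by (rule dunkl_op_cong[OF Rp smooth_on_dunkl_op[OF Rp
            smooth_on_mult[OF op smooth_on_norm_powr f]] _ x])
        (simp add: dunkl_op_norm_powr[OF Rp f])
    also have "\<dots> = a * ?T j (\<lambda>y. ?p (a - 2) y * (?l j y * f y)) x + ?T j (\<lambda>y. ?p a y * ?T j f y) x"
      by (simp add: dunkl_op_add[OF Rp smooth_on_mult[OF op smooth_on_const[OF op]
              smooth_on_mult[OF op smooth_on_norm_powr lf]] smooth_on_mult[OF op smooth_on_norm_powr Tf] x]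
            dunkl_op_cmult[OF Rp smooth_on_mult[OF op smooth_on_norm_powr lf] x])
    finally show ?thesis
      unfolding dunkl_op_norm_powr[OF Rp lf x] dunkl_op_norm_powr[OF Rp Tf x]
      by (simp add: algebra_simps)
  qed
  have sum_lT: "(\<Sum>j\<in>UNIV. ?l j x * ?T j f x) = euler_op f x + (\<Sum>\<alpha>\<in>Rp. k \<alpha>) * f x - ?F"
  proof -
    have "(\<Sum>j\<in>UNIV. ?l j x * ?T j f x) = (\<Sum>j\<in>UNIV. ?l j x * dir_deriv (\<xi> j) f x) +
        (\<Sum>j\<in>UNIV. \<Sum>\<alpha>\<in>Rp. k \<alpha> * (?l j \<alpha> * ?l j x) * diff_quotient \<alpha> f x)"
      by (simp add: dunkl_op_eq distrib_left sum.distrib sum_distrib_left inner_commute mult_ac)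
    also have "(\<Sum>j\<in>UNIV. ?l j x * dir_deriv (\<xi> j) f x) = euler_op f x"
      using dir_deriv_sum_direction[OF f, of x "\<lambda>j. \<xi> j \<bullet> x" \<xi> UNIV] x
      by (simp add: orthonormal_basis_expansion[OF \<xi>] euler_op_def)
    also have "(\<Sum>j\<in>UNIV. \<Sum>\<alpha>\<in>Rp. k \<alpha> * (?l j \<alpha> * ?l j x) * diff_quotient \<alpha> f x) =
        (\<Sum>\<alpha>\<in>Rp. \<Sum>j\<in>UNIV. k \<alpha> * diff_quotient \<alpha> f x * (?l j \<alpha> * ?l j x))"
      by (subst sum.swap) (simp add: mult_ac)
    also have "\<dots> = (\<Sum>\<alpha>\<in>Rp. k \<alpha> * (of_real (\<alpha> \<bullet> x) * diff_quotient \<alpha> f x))"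
      unfolding sum_distrib_left[symmetric] parseval by (simp add: mult_ac)
    also have "\<dots> = (\<Sum>\<alpha>\<in>Rp. k \<alpha>) * f x - ?F"
      by (simp add: times_diff_quotient right_diff_distrib sum_subtractf sum_distrib_right)
    finally show ?thesis by simp
  qed
  have sum_Tl: "(\<Sum>j\<in>UNIV. ?T j (\<lambda>y. ?l j y * f y) x) =
      of_nat CARD('n) * f x + (\<Sum>j\<in>UNIV. ?l j x * ?T j f x) + 2 * ?F"
  proof -
    have 1: "complex_of_real (\<xi> j \<bullet> \<xi> j) = 1" for j
      using \<xi> by (simp add: orthonormal_basis_def)
    have "(\<Sum>j\<in>UNIV. \<Sum>\<alpha>\<in>Rp. k \<alpha> * of_real (2 * (\<alpha> \<bullet> \<xi> j) * (\<alpha> \<bullet> \<xi> j) / (norm \<alpha>)\<^sup>2) * f (reflection \<alpha> x))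
      = (\<Sum>\<alpha>\<in>Rp. \<Sum>j\<in>UNIV. 2 / of_real ((norm \<alpha>)\<^sup>2) * k \<alpha> * f (reflection \<alpha> x) * (?l j \<alpha> * ?l j \<alpha>))"
      by (subst sum.swap) (simp add: inner_commute mult_ac)
    also have "\<dots> = (\<Sum>\<alpha>\<in>Rp. 2 * (k \<alpha> * f (reflection \<alpha> x)))"
    proof (rule sum.cong[OF refl])
      fix \<alpha> assume "\<alpha> \<in> Rp"
      then have "\<alpha> \<noteq> 0" using Rp by auto
      then show "(\<Sum>j\<in>UNIV. 2 / of_real ((norm \<alpha>)\<^sup>2) * k \<alpha> * f (reflection \<alpha> x) * (?l j \<alpha> * ?l j \<alpha>))
          = 2 * (k \<alpha> * f (reflection \<alpha> x))"
        unfolding sum_distrib_left[symmetric] parseval power2_norm_eq_inner by simp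
    qed
    finally show ?thesis
      by (simp add: dunkl_op_mult_inner[OF Rp f x] 1 sum.distrib sum_distrib_left)
  qed
  have "?p (a - 4) x * of_real (x \<bullet> x) = ?p (a - 2) x"
    using norm_powr_add[of "a - 4" 2 x] by (simp add: norm_powr_2 power2_norm_eq_inner)
  then have sum_ll: "(\<Sum>j\<in>UNIV. a * (a - 2) * ?p (a - 4) x * f x * (?l j x * ?l j x)) =
      a * (a - 2) * ?p (a - 2) x * f x"
    unfolding sum_distrib_left[symmetric] parseval by (simp add: mult_ac)
  show ?thesis
    unfolding dunkl_laplacian_def second sum.distrib sum_ll
    unfolding sum_distrib_left[symmetric] sum_Tl sum_lT
    by (simp add: algebra_simps)
qed

section \<open>Operators on the punctured space\<close>

lemma Cinf_punctured_iff: "f \<in> Cinf_punctured \<longleftrightarrow> smooth_on (- {0}) f \<and> f 0 = 0"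
  by (simp add: Cinf_punctured_def smooth_on_def)

text \<open>Linear operators on smooth functions off the origin whose value there does not see the value of
  the function at the origin. This locality allows such operators to be composed as formulas, while
  \<^const>\<open>punctured_op\<close> resets the value at the origin to \<open>0\<close> after each factor.\<close>

definition smooth_operator ::
    "((real ^ 'n \<Rightarrow> complex) \<Rightarrow> real ^ 'n \<Rightarrow> complex) \<Rightarrow> bool"
  where "smooth_operator T \<longleftrightarrow> (\<forall>f. smooth_on (- {0}) f \<longrightarrow>
    smooth_on (- {0}) (T f) \<and>
    (\<forall>x. x \<noteq> 0 \<longrightarrow>
      (\<forall>g. (\<forall>y. y \<noteq> 0 \<longrightarrow> f y = g y) \<longrightarrow> T f x = T g x) \<and>
      (\<forall>g. smooth_on (- {0}) g \<longrightarrow> T (\<lambda>y. f y + g y) x = T f x + T g x) \<and>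
      (\<forall>c. T (\<lambda>y. c * f y) x = c * T f x)))"

lemma smooth_operatorD:
  assumes "smooth_operator T" "smooth_on (- {0}) f"
  shows smooth_operator_smooth: "smooth_on (- {0}) (T f)"
    and smooth_operator_cong: "(\<And>y. y \<noteq> 0 \<Longrightarrow> f y = g y) \<Longrightarrow> x \<noteq> 0 \<Longrightarrow> T f x = T g x"
    and smooth_operator_add: "smooth_on (- {0}) g \<Longrightarrow> x \<noteq> 0 \<Longrightarrow> T (\<lambda>y. f y + g y) x = T f x + T g x"
    and smooth_operator_cmult: "x \<noteq> 0 \<Longrightarrow> T (\<lambda>y. c * f y) x = c * T f x"
  using assms unfolding smooth_operator_def by blast+

lemma smooth_on_punctured_op:
  assumes "smooth_operator T" "smooth_on (- {0}) f"
  shows "smooth_on (- {0}) (\<lambda>x. if x = 0 then 0 else T f x)"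
  by (rule smooth_on_cong[OF open_punctured _ smooth_operator_smooth[OF assms]]) auto

lemma punctured_op_in_End_space:
  fixes T :: "(real ^ 'n \<Rightarrow> complex) \<Rightarrow> real ^ 'n \<Rightarrow> complex"
  assumes "smooth_operator T"
  shows "punctured_op T \<in> End_space (pointwise_scale (*)) Cinf_punctured"
  unfolding End_space_def
proof (intro CollectI conjI ballI allI impI)
  fix f :: "real ^ 'n \<Rightarrow> complex" assume f: "f \<in> Cinf_punctured"
  then have fs: "smooth_on (- {0}) f" by (simp add: Cinf_punctured_iff)
  show "punctured_op T f \<in> Cinf_punctured"
    using f smooth_on_punctured_op[OF assms fs] by (simp add: punctured_op_def Cinf_punctured_iff)
  {
    fix g :: "real ^ 'n \<Rightarrow> complex" assume g: "g \<in> Cinf_punctured"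
    then have gs: "smooth_on (- {0}) g" by (simp add: Cinf_punctured_iff)
    have "f + g \<in> Cinf_punctured"
      using f g smooth_on_add[OF open_punctured fs gs] by (simp add: Cinf_punctured_iff plus_fun_def)
    then show "punctured_op T (f + g) = punctured_op T f + punctured_op T g"
      using f g smooth_operator_add[OF assms fs gs]
      by (simp add: punctured_op_def plus_fun_def fun_eq_iff)
  next
    fix c
    have "pointwise_scale (*) c f \<in> Cinf_punctured"
      using f smooth_on_mult[OF open_punctured smooth_on_const[OF open_punctured] fs]
      by (simp add: Cinf_punctured_iff pointwise_scale_def)
    then show "punctured_op T (pointwise_scale (*) c f) = pointwise_scale (*) c (punctured_op T f)"
      using f smooth_operator_cmult[OF assms fs]
      by (simp add: punctured_op_def pointwise_scale_def fun_eq_iff)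
  }
qed (simp add: punctured_op_def)

lemma punctured_op_cong:
  assumes "\<And>f x. smooth_on (- {0}) f \<Longrightarrow> x \<noteq> 0 \<Longrightarrow> S f x = T f x"
  shows "punctured_op S = punctured_op T"
  using assms by (auto simp: punctured_op_def Cinf_punctured_iff fun_eq_iff)

lemma pointwise_scale_punctured_op:
  "pointwise_scale (pointwise_scale (*)) c (punctured_op T) = punctured_op (\<lambda>f x. c * T f x)"
  by (auto simp: punctured_op_def pointwise_scale_def fun_eq_iff)

lemma commutator_punctured_op:
  fixes S T :: "(real ^ 'n \<Rightarrow> complex) \<Rightarrow> real ^ 'n \<Rightarrow> complex"
  assumes S: "smooth_operator S" and T: "smooth_operator T"
  shows "commutator (punctured_op S) (punctured_op T) = punctured_op (\<lambda>f x. S (T f) x - T (S f) x)"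
proof
  have comp: "punctured_op S (punctured_op T f) = (\<lambda>x. if x = 0 then 0 else S (T f) x)"
    if S: "smooth_operator S" and T: "smooth_operator T" and f: "f \<in> Cinf_punctured"
    for S T :: "(real ^ 'n \<Rightarrow> complex) \<Rightarrow> real ^ 'n \<Rightarrow> complex" and f
  proof -
    have fs: "smooth_on (- {0}) f" using f by (simp add: Cinf_punctured_iff)
    let ?g = "\<lambda>x. if x = 0 then 0 else T f x"
    have "?g \<in> Cinf_punctured"
      using smooth_on_punctured_op[OF T fs] by (simp add: Cinf_punctured_iff)
    moreover have "S ?g x = S (T f) x" if "x \<noteq> 0" for x
      by (rule smooth_operator_cong[OF S smooth_on_punctured_op[OF T fs] _ that]) simp
    ultimately show ?thesis using f by (auto simp: punctured_op_def)
  qed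
  fix f :: "real ^ 'n \<Rightarrow> complex"
  show "commutator (punctured_op S) (punctured_op T) f = punctured_op (\<lambda>f x. S (T f) x - T (S f) x) f"
  proof (cases "f \<in> Cinf_punctured")
    case True
    then show ?thesis
      by (auto simp: commutator_def comp[OF S T] comp[OF T S] fun_eq_iff) (auto simp: punctured_op_def)
  next
    case False
    have "punctured_op U 0 = 0" if U: "smooth_operator U" for U :: "(real ^ 'n \<Rightarrow> complex) \<Rightarrow> _"
      using smooth_operator_cmult[OF U smooth_on_const[OF open_punctured, of 0], of _ 0]
      by (auto simp: punctured_op_def fun_eq_iff zero_fun_def)
    with S T False show ?thesis by (simp add: commutator_def) (simp add: punctured_op_def)
  qed
qed

section \<open>The commutation relations\<close>

lemma euler_op_coordinates:
  fixes f :: "real ^ 'n \<Rightarrow> complex"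
  assumes "smooth_on (- {0}) f" "x \<noteq> 0"
  shows "(\<Sum>i\<in>UNIV. of_real (x $ i) * frechet_derivative f (at x) (axis i 1)) = euler_op f x"
  using dir_deriv_sum_direction[OF assms(1), of x "\<lambda>i. x $ i" "\<lambda>i. axis i 1" UNIV] assms(2)
    basis_expansion[of x]
  by (simp add: euler_op_def scalar_mult_eq_scaleR) (simp add: dir_deriv_def)

lemma E_plus_eq: "E_plus a = punctured_op (\<lambda>f x. \<i> / a * (norm_powr a x * f x))"
  by (simp add: E_plus_def norm_powr_def mult_ac)

lemma E_minus_eq: "E_minus \<xi> Rp k a =
    punctured_op (\<lambda>f x. \<i> / a * (norm_powr (2 - a) x * dunkl_laplacian \<xi> Rp k f x))"
  by (simp add: E_minus_def norm_powr_def mult_ac)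

lemma H_op_eq: "(H_op Rp k a :: (real ^ 'n \<Rightarrow> complex) \<Rightarrow> _) = punctured_op (\<lambda>f x.
    2 / a * euler_op f x + (of_nat CARD('n) + 2 * (\<Sum>\<alpha>\<in>Rp. k \<alpha>) + a - 2) / a * f x)"
  unfolding H_op_def by (rule punctured_op_cong) (simp add: euler_op_coordinates)

lemma smooth_operator_norm_powr: "smooth_operator (\<lambda>f x. c * (norm_powr b x * f x))"
  unfolding smooth_operator_def
  by (auto simp: algebra_simps intro!: smooth_on_mult smooth_on_const smooth_on_norm_powr)

lemma smooth_operator_norm_powr_dunkl_laplacian:
  fixes Rp :: "(real ^ 'n) set"
  assumes "0 \<notin> Rp"
  shows "smooth_operator (\<lambda>f x. c * (norm_powr b x * dunkl_laplacian \<xi> Rp k f x))"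
  unfolding smooth_operator_def
proof (intro allI impI conjI)
  fix f :: "real ^ 'n \<Rightarrow> complex" assume f: "smooth_on (- {0}) f"
  show "smooth_on (- {0}) (\<lambda>x. c * (norm_powr b x * dunkl_laplacian \<xi> Rp k f x))"
    by (intro smooth_on_mult smooth_on_const smooth_on_norm_powr open_punctured
        smooth_on_dunkl_laplacian assms f)
next
  fix f g :: "real ^ 'n \<Rightarrow> complex" and x :: "real ^ 'n"
  assume "smooth_on (- {0}) f" "\<forall>y. y \<noteq> 0 \<longrightarrow> f y = g y" "x \<noteq> 0"
  then show "c * (norm_powr b x * dunkl_laplacian \<xi> Rp k f x) =
      c * (norm_powr b x * dunkl_laplacian \<xi> Rp k g x)"
    using dunkl_laplacian_cong[OF assms] by metis
qed (simp_all add: dunkl_laplacian_add[OF assms] dunkl_laplacian_cmult[OF assms] algebra_simps)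

lemma smooth_operator_euler_op:
  "smooth_operator (\<lambda>f x. b * euler_op f x + c * f x :: complex)"
  unfolding smooth_operator_def
proof (intro allI impI conjI)
  fix f :: "real ^ 'n \<Rightarrow> complex" assume f: "smooth_on (- {0}) f"
  show "smooth_on (- {0}) (\<lambda>x. b * euler_op f x + c * f x)"
    by (intro smooth_on_add smooth_on_mult smooth_on_const smooth_on_euler_op open_punctured f)
  fix x :: "real ^ 'n" assume x: "x \<noteq> 0"
  show "b * euler_op f x + c * f x = b * euler_op g x + c * g x"
    if "\<forall>y. y \<noteq> 0 \<longrightarrow> f y = g y" for g
    using dir_deriv_cong[OF open_punctured _ _ f, of x g x] that x by (simp add: euler_op_def)
  show "b * euler_op (\<lambda>y. f y + g y) x + c * (f x + g x) =
      b * euler_op f x + c * f x + (b * euler_op g x + c * g x)" if "smooth_on (- {0}) g" for g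
    using euler_op_add[OF f that, of x] x by (simp add: algebra_simps)
  show "b * euler_op (\<lambda>y. d * f y) x + c * (d * f x) = d * (b * euler_op f x + c * f x)" for d
    using dir_deriv_cmult[OF f, of x x d] x by (simp add: euler_op_def algebra_simps)
qed

text \<open>The term \<open>norm_powr a x * \<Delta>\<^sub>k f\<close> cancels in the commutator, and the powers of the norm in the remaining
  first-order term multiply to \<open>1\<close>.\<close>

lemma commutator_E_plus_E_minus:
  fixes Rp :: "(real ^ 'n) set"
  assumes Rp: "0 \<notin> Rp" and \<xi>: "orthonormal_basis \<xi>" and a: "a \<noteq> 0"
  shows "commutator (E_plus a) (E_minus \<xi> Rp k a) = H_op Rp k a"
  unfolding E_plus_eq E_minus_eq H_op_eq
    commutator_punctured_op[OF smooth_operator_norm_powr smooth_operator_norm_powr_dunkl_laplacian[OF Rp]]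
proof (rule punctured_op_cong)
  fix f :: "real ^ 'n \<Rightarrow> complex" and x :: "real ^ 'n"
  assume f: "smooth_on (- {0}) f" and x: "x \<noteq> 0"
  let ?p = "\<lambda>b. norm_powr b x" and ?L = "dunkl_laplacian \<xi> Rp k f x"
  define B where "B = (of_nat CARD('n) + 2 * (\<Sum>\<alpha>\<in>Rp. k \<alpha>) + a - 2) * f x + 2 * euler_op f x"
  have "?p (2 - a) * ?p (a - 2) = 1"
    using norm_powr_add[of "2 - a" "a - 2" x] norm_powr_0[OF x] by simp
  then have cancel: "?p (2 - a) * (?p (a - 2) * z) = z" for z
    by (metis mult.assoc mult_1)
  have L: "dunkl_laplacian \<xi> Rp k (\<lambda>y. \<i> / a * (norm_powr a y * f y)) x =
      \<i> / a * (?p a * ?L + a * ?p (a - 2) * B)"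
    by (simp only: dunkl_laplacian_cmult[OF Rp smooth_on_mult[OF open_punctured smooth_on_norm_powr f] x]
        dunkl_laplacian_norm_powr[OF Rp \<xi> f x] B_def)
  have "\<i> / a * (?p a * (\<i> / a * (?p (2 - a) * ?L))) -
      \<i> / a * (?p (2 - a) * dunkl_laplacian \<xi> Rp k (\<lambda>y. \<i> / a * (norm_powr a y * f y)) x) =
      - (\<i> * \<i>) / a * (?p (2 - a) * (?p (a - 2) * B))"
    unfolding L using a by (simp add: field_simps)
  also have "\<dots> = 2 / a * euler_op f x + (of_nat CARD('n) + 2 * (\<Sum>\<alpha>\<in>Rp. k \<alpha>) + a - 2) / a * f x"
    unfolding cancel B_def using a by (simp add: field_simps)
  finally show "\<i> / a * (?p a * (\<i> / a * (?p (2 - a) * ?L))) -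
      \<i> / a * (?p (2 - a) * dunkl_laplacian \<xi> Rp k (\<lambda>y. \<i> / a * (norm_powr a y * f y)) x) =
      2 / a * euler_op f x + (of_nat CARD('n) + 2 * (\<Sum>\<alpha>\<in>Rp. k \<alpha>) + a - 2) / a * f x" .
qed

lemma euler_op_norm_powr_mult:
  fixes f :: "real ^ 'n \<Rightarrow> complex"
  assumes "smooth_on (- {0}) f" "x \<noteq> 0"
  shows "euler_op (\<lambda>y. c * (norm_powr b y * f y)) x = c * norm_powr b x * (euler_op f x + b * f x)"
proof -
  have x: "x \<in> - {0}" using assms(2) by simp
  show ?thesis
    using dir_deriv_cmult[OF smooth_on_mult[OF open_punctured smooth_on_norm_powr assms(1)] x, of x c b]
      euler_op_mult[OF smooth_on_norm_powr assms(1) x, of b]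
    by (simp add: euler_op_norm_powr[OF assms(2)] algebra_simps flip: euler_op_def)
qed

lemma commutator_H_op_E_plus:
  fixes Rp :: "(real ^ 'n) set"
  assumes "a \<noteq> 0"
  shows "commutator (H_op Rp k a) (E_plus a) = pointwise_scale (pointwise_scale (*)) 2 (E_plus a)"
  unfolding E_plus_eq H_op_eq pointwise_scale_punctured_op
    commutator_punctured_op[OF smooth_operator_euler_op smooth_operator_norm_powr]
proof (rule punctured_op_cong)
  fix f :: "real ^ 'n \<Rightarrow> complex" and x :: "real ^ 'n"
  assume f: "smooth_on (- {0}) f" and x: "x \<noteq> 0"
  define c where "c = (of_nat CARD('n) + 2 * (\<Sum>\<alpha>\<in>Rp. k \<alpha>) + a - 2) / a"
  have "2 / a * (\<i> / a * norm_powr a x * (euler_op f x + a * f x)) + c * (\<i> / a * (norm_powr a x * f x)) -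
      \<i> / a * (norm_powr a x * (2 / a * euler_op f x + c * f x)) = 2 * (\<i> / a * (norm_powr a x * f x))"
    using assms by (simp add: field_simps)
  then show "2 / a * euler_op (\<lambda>x. \<i> / a * (norm_powr a x * f x)) x +
      (of_nat CARD('n) + 2 * (\<Sum>\<alpha>\<in>Rp. k \<alpha>) + a - 2) / a * (\<i> / a * (norm_powr a x * f x)) -
      \<i> / a * (norm_powr a x * (2 / a * euler_op f x +
        (of_nat CARD('n) + 2 * (\<Sum>\<alpha>\<in>Rp. k \<alpha>) + a - 2) / a * f x)) =
      2 * (\<i> / a * (norm_powr a x * f x))"
    unfolding c_def euler_op_norm_powr_mult[OF f x] .
qed

text \<open>Both relations for \<open>H\<close> count degrees: the scalar part of \<open>H\<close> commutes with everything, and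
  \<open>\<Delta>\<^sub>k\<close> followed by multiplication by \<open>norm_powr (2 - a)\<close> has degree \<open>(2 - a) - 2 = - a\<close>.\<close>

lemma commutator_H_op_E_minus:
  fixes Rp :: "(real ^ 'n) set"
  assumes Rp: "0 \<notin> Rp" and a: "a \<noteq> 0"
  shows "commutator (H_op Rp k a) (E_minus \<xi> Rp k a) =
    pointwise_scale (pointwise_scale (*)) (- 2) (E_minus \<xi> Rp k a)"
  unfolding E_minus_eq H_op_eq pointwise_scale_punctured_op
    commutator_punctured_op[OF smooth_operator_euler_op smooth_operator_norm_powr_dunkl_laplacian[OF Rp]]
proof (rule punctured_op_cong)
  fix f :: "real ^ 'n \<Rightarrow> complex" and x :: "real ^ 'n"
  assume f: "smooth_on (- {0}) f" and x: "x \<noteq> 0"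
  define c where "c = (of_nat CARD('n) + 2 * (\<Sum>\<alpha>\<in>Rp. k \<alpha>) + a - 2) / a"
  define L where "L = dunkl_laplacian \<xi> Rp k f"
  define p where "p = norm_powr (2 - a) x"
  have Ef: "smooth_on (- {0}) (euler_op f)" by (rule smooth_on_euler_op[OF open_punctured f])
  note cm = smooth_on_mult[OF open_punctured smooth_on_const[OF open_punctured]]
  have 1: "dunkl_laplacian \<xi> Rp k (\<lambda>y. 2 / a * euler_op f y + c * f y) x =
      2 / a * (euler_op L x + 2 * L x) + c * L x"
    by (simp only: dunkl_laplacian_add[OF Rp cm[OF Ef] cm[OF f] x] L_def
        dunkl_laplacian_cmult[OF Rp Ef x] dunkl_laplacian_cmult[OF Rp f x] dunkl_laplacian_euler_op[OF Rp f x])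
  have 2: "euler_op (\<lambda>y. \<i> / a * (norm_powr (2 - a) y * L y)) x =
      \<i> / a * p * (euler_op L x + (2 - a) * L x)"
    unfolding L_def p_def by (rule euler_op_norm_powr_mult[OF smooth_on_dunkl_laplacian[OF Rp f] x])
  have "2 / a * euler_op (\<lambda>y. \<i> / a * (norm_powr (2 - a) y * L y)) x +
      c * (\<i> / a * (p * L x)) -
      \<i> / a * (p * dunkl_laplacian \<xi> Rp k (\<lambda>y. 2 / a * euler_op f y + c * f y) x) =
      - 2 * (\<i> / a * (p * L x))"
    unfolding 1 2 using a by (simp add: field_simps)
  then show "2 / a * euler_op (\<lambda>y. \<i> / a * (norm_powr (2 - a) y * dunkl_laplacian \<xi> Rp k f y)) x +
      (of_nat CARD('n) + 2 * (\<Sum>\<alpha>\<in>Rp. k \<alpha>) + a - 2) / a *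
        (\<i> / a * (norm_powr (2 - a) x * dunkl_laplacian \<xi> Rp k f x)) -
      \<i> / a * (norm_powr (2 - a) x * dunkl_laplacian \<xi> Rp k (\<lambda>y. 2 / a * euler_op f y +
        (of_nat CARD('n) + 2 * (\<Sum>\<alpha>\<in>Rp. k \<alpha>) + a - 2) / a * f y) x) =
      - 2 * (\<i> / a * (norm_powr (2 - a) x * dunkl_laplacian \<xi> Rp k f x))"
    unfolding c_def L_def p_def .
qed

text \<open>The power \<open>norm_powr b\<close> is an eigenvector of \<open>H\<close>, and its eigenvalue depends on \<open>b\<close>; hence the
  eigenvalues for \<open>b = 0\<close> and \<open>b = a\<close> are not both \<open>0\<close>.\<close>

lemma H_op_nonzero:
  assumes "a \<noteq> 0"
  shows "(H_op Rp k a :: (real ^ 'n \<Rightarrow> complex) \<Rightarrow> _) \<noteq> 0"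
proof
  let ?c = "(of_nat CARD('n) + 2 * (\<Sum>\<alpha>\<in>Rp. k \<alpha>) + a - 2) / a"
  assume H: "(H_op Rp k a :: (real ^ 'n \<Rightarrow> complex) \<Rightarrow> _) = 0"
  have eigen: "2 / a * b + ?c = 0" for b
  proof -
    define x :: "real ^ 'n" where "x = axis undefined 1"
    have x: "x \<noteq> 0" by (simp add: x_def axis_eq_0_iff)
    have "norm_powr b \<in> (Cinf_punctured :: (real ^ 'n \<Rightarrow> complex) set)"
      by (simp add: Cinf_punctured_iff smooth_on_norm_powr norm_powr_def)
    then have "H_op Rp k a (norm_powr b) x = (2 / a * b + ?c) * norm_powr b x"
      using x by (simp add: H_op_eq punctured_op_def euler_op_norm_powr algebra_simps)
    moreover have "norm_powr b x \<noteq> 0"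
      using x by (simp add: norm_powr_def)
    ultimately show ?thesis using H by simp
  qed
  show False using eigen[of 0] eigen[of a] assms by simp
qed

theorem lemmaF:
  fixes R Rp :: "(real ^ 'n) set"
    and k :: "real ^ 'n \<Rightarrow> complex"
    and a :: complex
    and \<xi> :: "'n \<Rightarrow> real ^ 'n"
  assumes "root_system R"
    and "multiplicity_function R k"
    and "positive_subsystem R Rp"
    and "orthonormal_basis \<xi>"
    and "a \<noteq> 0"
  shows "sl2_triple (pointwise_scale (pointwise_scale (*)))
    (End_space (pointwise_scale (*)) Cinf_punctured) commutator
    (E_plus a) (E_minus \<xi> Rp k a) (H_op Rp k a)"
proof -
  have Rp: "0 \<notin> Rp"
    using assms(1,3) by (auto simp: root_system_def positive_subsystem_def)
  let ?V = "Cinf_punctured :: (real ^ 'n \<Rightarrow> complex) set"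
  interpret F: vector_space "pointwise_scale (*) :: complex \<Rightarrow> (real ^ 'n \<Rightarrow> complex) \<Rightarrow> _"
    by unfold_locales (auto simp: pointwise_scale_def fun_eq_iff algebra_simps)
  have "F.subspace ?V"
    unfolding F.subspace_def
    by (auto simp: Cinf_punctured_iff plus_fun_def zero_fun_def pointwise_scale_def
        intro!: smooth_on_const smooth_on_add smooth_on_mult)
  then have lie: "lie_algebra (pointwise_scale (pointwise_scale (*)))
      (End_space (pointwise_scale (*)) ?V) commutator"
    by (rule lie_algebra_End_space[OF F.vector_space_axioms])
  note comm = commutator_E_plus_E_minus[OF Rp assms(4,5), of k]
  note H = H_op_nonzero[OF assms(5), of Rp k]
  have End: "E_plus a \<in> End_space (pointwise_scale (*)) ?V"
    "E_minus \<xi> Rp k a \<in> End_space (pointwise_scale (*)) ?V"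
    "H_op Rp k a \<in> End_space (pointwise_scale (*)) ?V"
    unfolding E_plus_eq E_minus_eq H_op_eq
    by (intro punctured_op_in_End_space smooth_operator_norm_powr
        smooth_operator_norm_powr_dunkl_laplacian smooth_operator_euler_op Rp)+
  \<comment> \<open>as \<open>[E\<^sup>+, E\<^sup>-] = H\<close> is non-zero, so are both factors\<close>
  interpret lie_algebra "pointwise_scale (pointwise_scale (*))" "End_space (pointwise_scale (*)) ?V" commutator
    by (rule lie)
  have "commutator 0 (E_minus \<xi> Rp k a) = 0" "commutator (E_plus a) 0 = (0 :: (real ^ 'n \<Rightarrow> complex) \<Rightarrow> _)"
    using bracket_scale_left[OF End(1,2), of 0] bracket_scale_right[OF End(1) End(2), of 0] by simp_all
  then have "E_plus a \<noteq> (0 :: (real ^ 'n \<Rightarrow> complex) \<Rightarrow> _)" "E_minus \<xi> Rp k a \<noteq> 0"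
    using comm H by auto
  then show ?thesis
    unfolding sl2_triple_def
    using lie End H comm commutator_H_op_E_plus[OF assms(5)] commutator_H_op_E_minus[OF Rp assms(5)]
    by blast
qed

end
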